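(* Let $E\subset\mathbb{R}$ be a measurable set with $0<\operatorname{mes}E\le\infty$. If the set $E$ is symmetric, then the truncated Fourier operator $\mathscr{F}_E$ is a normal operator in $L^2(E)$, that is, $\mathscr{F}_E^{\ast}\mathscr{F}_E=\mathscr{F}_E\mathscr{F}_E^{\ast}$.
   Context: $\operatorname{mes}$ denotes Lebesgue measure on $\mathbb{R}$; $L^2(E)$ is the complex Hilbert space of square-integrable functions on $E$. The truncated Fourier operator $\mathscr{F}_E:L^2(E)\to L^2(E)$ is $(\mathscr{F}_Ex)(t)=\frac{1}{\sqrt{2\pi}}\int_E e^{it\xi}x(\xi)\,d\xi$, $t\in E$; when $\operatorname{mes}E=\infty$ the integral is understood in the Fourier–Plancherel sense, i.e. $\mathscr{F}_Ex$ is the restriction to $E$ of the $L^2(\mathbb{R})$ Fourier–Plancherel transform (the unitary extension of $x\mapsto\frac{1}{\sqrt{2\pi}}\int_{\mathbb{R}}e^{it\xi}x(\xi)\,d\xi$) of $x$ extended by zero outside $E$. $\mathscr{F}_E^{\ast}$ is its Hilbert space adjoint. Put $-E=\{t\in\mathbb{R}:-t\in E\}$. The set $E$ is called symmetric if $\operatorname{mes}\Delta(E,-E)=0$, where $\Delta(E,-E)=(E\setminus(-E))\cup((-E)\setminus E)$. *)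

theory Defs
  imports "HOL-Analysis.Analysis"
begin

section \<open>The complex Hilbert space of square-integrable functions\<close>

definition L2_functions :: "'a measure \<Rightarrow> ('a \<Rightarrow> complex) set" where
  "L2_functions M =
     {x. x \<in> borel_measurable M \<and> integrable M (\<lambda>t. (cmod (x t))\<^sup>2)}"

definition L2_rel :: "'a measure \<Rightarrow> ('a \<Rightarrow> complex) rel" where
  "L2_rel M = {(x, y). x \<in> L2_functions M \<and> y \<in> L2_functions M \<and> (AE t in M. x t = y t)}"

text \<open>Elements of the Hilbert space are classes of functions modulo equality almost everywhere.
  For \<open>M = lebesgue_on E\<close>, values outside \<open>E\<close> are irrelevant, so this is the space over \<open>E\<close>.\<close>

definition L2_space :: "'a measure \<Rightarrow> ('a \<Rightarrow> complex) set set" where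
  "L2_space M = L2_functions M // L2_rel M"

definition L2_class :: "'a measure \<Rightarrow> ('a \<Rightarrow> complex) \<Rightarrow> ('a \<Rightarrow> complex) set" where
  "L2_class M x = L2_rel M `` {x}"

definition L2_rep :: "('a \<Rightarrow> complex) set \<Rightarrow> 'a \<Rightarrow> complex" where
  "L2_rep u = (SOME x. x \<in> u)"

definition L2_add ::
  "'a measure \<Rightarrow> ('a \<Rightarrow> complex) set \<Rightarrow> ('a \<Rightarrow> complex) set \<Rightarrow> ('a \<Rightarrow> complex) set" where
  "L2_add M u v = L2_class M (\<lambda>t. L2_rep u t + L2_rep v t)"

definition L2_scale ::
  "'a measure \<Rightarrow> complex \<Rightarrow> ('a \<Rightarrow> complex) set \<Rightarrow> ('a \<Rightarrow> complex) set" where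
  "L2_scale M c u = L2_class M (\<lambda>t. c * L2_rep u t)"

definition L2_inner ::
  "'a measure \<Rightarrow> ('a \<Rightarrow> complex) set \<Rightarrow> ('a \<Rightarrow> complex) set \<Rightarrow> complex" where
  "L2_inner M u v = (LINT t|M. L2_rep u t * cnj (L2_rep v t))"

definition L2_norm :: "'a measure \<Rightarrow> ('a \<Rightarrow> complex) set \<Rightarrow> real" where
  "L2_norm M u = sqrt (Re (L2_inner M u u))"

lemma equiv_L2_rel: "equiv (L2_functions M) (L2_rel M)"
proof (rule equivI)
  show "L2_rel M \<subseteq> L2_functions M \<times> L2_functions M"
    by (auto simp: L2_rel_def)
  show "refl_on (L2_functions M) (L2_rel M)"
    by (auto simp: refl_on_def L2_rel_def)
  show "sym (L2_rel M)"
    by (auto simp: sym_def L2_rel_def elim: AE_mp)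
  show "trans (L2_rel M)"
    by (auto simp: trans_def L2_rel_def)
qed

lemma L2_rep_class:
  assumes "x \<in> L2_functions M"
  shows "L2_rep (L2_class M x) \<in> L2_functions M"
    and "AE t in M. L2_rep (L2_class M x) t = x t"
proof -
  have "x \<in> L2_class M x"
    using assms by (auto simp: L2_class_def L2_rel_def)
  then have "L2_rep (L2_class M x) \<in> L2_class M x"
    unfolding L2_rep_def by (rule someI[of "\<lambda>z. z \<in> L2_class M x"])
  then have "(x, L2_rep (L2_class M x)) \<in> L2_rel M"
    by (simp add: L2_class_def)
  then show "L2_rep (L2_class M x) \<in> L2_functions M"
    and "AE t in M. L2_rep (L2_class M x) t = x t"
    by (auto simp: L2_rel_def elim: AE_mp)
qed

lemma L2_inner_class:
  assumes x: "x \<in> L2_functions M" and y: "y \<in> L2_functions M"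
  shows "L2_inner M (L2_class M x) (L2_class M y) = (LINT t|M. x t * cnj (y t))"
  unfolding L2_inner_def
proof (rule integral_cong_AE)
  have m: "z \<in> borel_measurable M \<Longrightarrow> (\<lambda>t. cnj (z t)) \<in> borel_measurable M" for z
    by (rule borel_measurable_continuous_on[of cnj]) (auto intro: continuous_intros)
  show "(\<lambda>t. L2_rep (L2_class M x) t * cnj (L2_rep (L2_class M y) t)) \<in> borel_measurable M"
    using L2_rep_class(1)[OF x] L2_rep_class(1)[OF y]
    by (auto simp: L2_functions_def intro!: borel_measurable_times m)
  show "(\<lambda>t. x t * cnj (y t)) \<in> borel_measurable M"
    using x y by (auto simp: L2_functions_def intro!: borel_measurable_times m)
  show "AE t in M. L2_rep (L2_class M x) t * cnj (L2_rep (L2_class M y) t) = x t * cnj (y t)"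
    using L2_rep_class(2)[OF x] L2_rep_class(2)[OF y] by eventually_elim simp
qed

section \<open>Operators\<close>

text \<open>Operators are extensional functions on the carrier \<open>L2_space M\<close>, so that the operators
  picked out below by definite descriptions are unique.\<close>

definition L2_linear ::
  "'a measure \<Rightarrow> (('a \<Rightarrow> complex) set \<Rightarrow> ('a \<Rightarrow> complex) set) \<Rightarrow> bool" where
  "L2_linear M T \<longleftrightarrow>
     T \<in> L2_space M \<rightarrow>\<^sub>E L2_space M \<and>
     (\<forall>u\<in>L2_space M. \<forall>v\<in>L2_space M. T (L2_add M u v) = L2_add M (T u) (T v)) \<and>
     (\<forall>c. \<forall>u\<in>L2_space M. T (L2_scale M c u) = L2_scale M c (T u))"

definition L2_bounded_linear ::
  "'a measure \<Rightarrow> (('a \<Rightarrow> complex) set \<Rightarrow> ('a \<Rightarrow> complex) set) \<Rightarrow> bool" where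
  "L2_bounded_linear M T \<longleftrightarrow>
     L2_linear M T \<and> (\<exists>C. \<forall>u\<in>L2_space M. L2_norm M (T u) \<le> C * L2_norm M u)"

definition L2_unitary ::
  "'a measure \<Rightarrow> (('a \<Rightarrow> complex) set \<Rightarrow> ('a \<Rightarrow> complex) set) \<Rightarrow> bool" where
  "L2_unitary M T \<longleftrightarrow>
     L2_linear M T \<and> T ` L2_space M = L2_space M \<and>
     (\<forall>u\<in>L2_space M. \<forall>v\<in>L2_space M. L2_inner M (T u) (T v) = L2_inner M u v)"

definition L2_adjoint ::
  "'a measure \<Rightarrow> (('a \<Rightarrow> complex) set \<Rightarrow> ('a \<Rightarrow> complex) set)
     \<Rightarrow> (('a \<Rightarrow> complex) set \<Rightarrow> ('a \<Rightarrow> complex) set)" where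
  "L2_adjoint M T =
     (THE S. S \<in> L2_space M \<rightarrow>\<^sub>E L2_space M \<and>
        (\<forall>u\<in>L2_space M. \<forall>v\<in>L2_space M. L2_inner M (T u) v = L2_inner M u (S v)))"

definition L2_normal ::
  "'a measure \<Rightarrow> (('a \<Rightarrow> complex) set \<Rightarrow> ('a \<Rightarrow> complex) set) \<Rightarrow> bool" where
  "L2_normal M T \<longleftrightarrow>
     L2_bounded_linear M T \<and>
     (\<forall>u\<in>L2_space M. L2_adjoint M T (T u) = T (L2_adjoint M T u))"

section \<open>The truncated Fourier operator\<close>

definition fourier_integral :: "real set \<Rightarrow> (real \<Rightarrow> complex) \<Rightarrow> real \<Rightarrow> complex" where
  "fourier_integral E x t =
     1 / complex_of_real (sqrt (2 * pi)) *
       (LINT \<xi>|lebesgue_on E. exp (\<i> * complex_of_real (t * \<xi>)) * x \<xi>)"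

text \<open>The unitary operator on the whole line that extends the Fourier integral, which is given
  on the dense subspace of functions that are both integrable and square-integrable.\<close>

definition fourier_plancherel :: "(real \<Rightarrow> complex) set \<Rightarrow> (real \<Rightarrow> complex) set" where
  "fourier_plancherel =
     (THE T. L2_unitary lebesgue T \<and>
        (\<forall>x\<in>L2_functions lebesgue. integrable lebesgue x \<longrightarrow>
           T (L2_class lebesgue x) = L2_class lebesgue (fourier_integral UNIV x)))"

definition L2_extend_by_zero :: "real set \<Rightarrow> (real \<Rightarrow> complex) set \<Rightarrow> (real \<Rightarrow> complex) set" where
  "L2_extend_by_zero E u = L2_class lebesgue (\<lambda>t. if t \<in> E then L2_rep u t else 0)"

definition L2_restrict :: "real set \<Rightarrow> (real \<Rightarrow> complex) set \<Rightarrow> (real \<Rightarrow> complex) set" where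
  "L2_restrict E u = L2_class (lebesgue_on E) (L2_rep u)"

definition truncated_fourier ::
  "real set \<Rightarrow> (real \<Rightarrow> complex) set \<Rightarrow> (real \<Rightarrow> complex) set" where
  "truncated_fourier E =
     (\<lambda>u\<in>L2_space (lebesgue_on E).
        if emeasure lebesgue E < \<infinity>
        then L2_class (lebesgue_on E) (fourier_integral E (L2_rep u))
        else L2_restrict E (fourier_plancherel (L2_extend_by_zero E u)))"

definition symmetric_set :: "real set \<Rightarrow> bool" where
  "symmetric_set E \<longleftrightarrow>
     emeasure lebesgue ((E - {t. - t \<in> E}) \<union> ({t. - t \<in> E} - E)) = 0"

end

theory Submission
  imports Defs "HOL-Probability.Characteristic_Functions"
begin

text \<open>The adjoint of the compression of the Fourier--Plancherel operator to \<open>E\<close> is its composition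
  with the reflection \<open>t \<mapsto> - t\<close>. If \<open>E\<close> is symmetric, the reflection acts on the space over \<open>E\<close> and
  commutes with the compression, which is therefore normal.

  The Fourier--Plancherel operator is obtained from a Gaussian regularisation of Parseval's
  formula. For integrable \<open>x\<close> it yields \<open>\<parallel>\<F>x\<parallel> \<le> \<parallel>x\<parallel>\<close>, so that \<open>\<F>\<close> extends to all square-integrable
  functions by completeness, and Parseval's formula against indicators of intervals, which shows
  that \<open>\<F>\<close> composed with complex conjugation is an involution. The isometry and the surjectivity
  of \<open>\<F>\<close> both follow from this.\<close>

section \<open>Square-integrable functions\<close>

text \<open>The kernel exp(i t \<xi>) is symmetric in t and \<xi>, so the transform F is symmetric
  for the pairing without conjugation, and F commutes with conjugation up to the reflection R; this
  is why the adjoint of F is R F. With P the cut-off to E, the operator is PFP and its adjoint is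
  PRFP; if RP = PR, then both products equal PRFPFP. The obstacle is that
  \<open>fourier_plancherel\<close> and \<open>L2_adjoint\<close> are definite descriptions over
  operators on classes of functions: each value must be constructed and shown unique before it can
  be used. The analysis is therefore done on functions with the relation
  \<open>plancherel_pair\<close>, and classes enter last. The Gaussian factor is there because F x
  need not be integrable for integrable x, so Fubini's theorem does not apply directly to a product
  of two transforms. Removing the factor is cheap: Fatou's lemma suffices for the norm bound, and
  for an indicator the averages converge off the endpoints. Inversion thus comes before isometry,
  which follows by pairing F x with the conjugate of F x'.\<close>

definition L2_sq :: "'a measure \<Rightarrow> ('a \<Rightarrow> complex) \<Rightarrow> real" where
  "L2_sq M x = (LINT t|M. (cmod (x t))\<^sup>2)"

text \<open>Membership is part of the definition because the integral of a non-integrable function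
  has the default value 0, so \<open>L2_sq\<close> could otherwise tend to 0 for no reason.\<close>

definition L2_tendsto :: "'a measure \<Rightarrow> (nat \<Rightarrow> 'a \<Rightarrow> complex) \<Rightarrow> ('a \<Rightarrow> complex) \<Rightarrow> bool" where
  "L2_tendsto M f y \<longleftrightarrow>
     (\<forall>n. f n \<in> L2_functions M) \<and> y \<in> L2_functions M \<and> (\<lambda>n. L2_sq M (\<lambda>t. f n t - y t)) \<longlonglongrightarrow> 0"

lemma borel_measurable_cnj [measurable (raw)]:
  "x \<in> borel_measurable M \<Longrightarrow> (\<lambda>t. cnj (x t)) \<in> borel_measurable M"
  by (rule borel_measurable_continuous_on[of cnj]) (auto intro: continuous_intros)

lemma L2_measurable [measurable_dest]: "x \<in> L2_functions M \<Longrightarrow> x \<in> borel_measurable M"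
  by (simp add: L2_functions_def)

lemma L2_integrable_sq: "x \<in> L2_functions M \<Longrightarrow> integrable M (\<lambda>t. (cmod (x t))\<^sup>2)"
  by (simp add: L2_functions_def)

lemma L2_sq_nonneg [simp]: "0 \<le> L2_sq M x"
  by (simp add: L2_sq_def)

text \<open>This crude bound stands in for Minkowski's inequality: the factor 2 does no harm to
  integrability or to limits equal to 0.\<close>

lemma norm_add_sq_le: "(norm (a + b))\<^sup>2 \<le> 2 * (norm a)\<^sup>2 + 2 * (norm b)\<^sup>2"
  for a b :: "'a::real_normed_vector"
proof -
  have "(norm (a + b))\<^sup>2 \<le> (norm a + norm b)\<^sup>2"
    by (intro power_mono norm_triangle_ineq) auto
  also have "\<dots> \<le> 2 * (norm a)\<^sup>2 + 2 * (norm b)\<^sup>2"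
    using zero_le_power2[of "norm a - norm b"] unfolding power2_sum power2_diff by linarith
  finally show ?thesis .
qed

lemma L2_add:
  assumes "x \<in> L2_functions M" "y \<in> L2_functions M"
  shows "(\<lambda>t. x t + y t) \<in> L2_functions M"
    and "L2_sq M (\<lambda>t. x t + y t) \<le> 2 * L2_sq M x + 2 * L2_sq M y"
proof -
  note [measurable] = assms
  have i: "integrable M (\<lambda>t. 2 * (cmod (x t))\<^sup>2 + 2 * (cmod (y t))\<^sup>2)"
    using assms by (auto simp: L2_functions_def)
  have i': "integrable M (\<lambda>t. (cmod (x t + y t))\<^sup>2)"
    by (rule Bochner_Integration.integrable_bound[OF i]) (auto simp: norm_add_sq_le)
  then show "(\<lambda>t. x t + y t) \<in> L2_functions M"
    by (simp add: L2_functions_def)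
  have "L2_sq M (\<lambda>t. x t + y t) \<le> (LINT t|M. 2 * (cmod (x t))\<^sup>2 + 2 * (cmod (y t))\<^sup>2)"
    unfolding L2_sq_def by (rule integral_mono[OF i' i norm_add_sq_le])
  also have "\<dots> = 2 * L2_sq M x + 2 * L2_sq M y"
    using assms by (simp add: L2_sq_def L2_integrable_sq)
  finally show "L2_sq M (\<lambda>t. x t + y t) \<le> 2 * L2_sq M x + 2 * L2_sq M y" .
qed

lemma L2_cmult:
  assumes "x \<in> L2_functions M"
  shows "(\<lambda>t. c * x t) \<in> L2_functions M"
    and "L2_sq M (\<lambda>t. c * x t) = (cmod c)\<^sup>2 * L2_sq M x"
  using assms by (auto simp: L2_functions_def L2_sq_def norm_mult power_mult_distrib)

lemma L2_uminus: "x \<in> L2_functions M \<Longrightarrow> (\<lambda>t. - x t) \<in> L2_functions M"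
  by (auto simp: L2_functions_def)

lemma L2_diff:
  assumes "x \<in> L2_functions M" "y \<in> L2_functions M"
  shows "(\<lambda>t. x t - y t) \<in> L2_functions M"
    and "L2_sq M (\<lambda>t. x t - y t) \<le> 2 * L2_sq M x + 2 * L2_sq M y"
  using L2_add[OF assms(1) L2_uminus[OF assms(2)]] by (simp_all add: L2_sq_def)

lemma L2_cnj:
  assumes "x \<in> L2_functions M"
  shows "(\<lambda>t. cnj (x t)) \<in> L2_functions M" and "L2_sq M (\<lambda>t. cnj (x t)) = L2_sq M x"
  using assms by (auto simp: L2_functions_def L2_sq_def)

lemma complex_of_real_L2_sq: "complex_of_real (L2_sq M x) = (LINT t|M. x t * cnj (x t))"
  unfolding L2_sq_def integral_complex_of_real[symmetric] by (simp only: complex_norm_square)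

lemma L2_sq_zero_imp_AE:
  assumes "x \<in> L2_functions M" "L2_sq M x = 0"
  shows "AE t in M. x t = 0"
proof -
  have "AE t in M. (cmod (x t))\<^sup>2 = 0"
    using integral_nonneg_eq_0_iff_AE[OF L2_integrable_sq[OF assms(1)]] assms(2)
    by (simp add: L2_sq_def)
  then show ?thesis by eventually_elim simp
qed

lemma L2_cong_AE:
  assumes "x \<in> L2_functions M" "y \<in> borel_measurable M" "AE t in M. x t = y t"
  shows "y \<in> L2_functions M" and "L2_sq M y = L2_sq M x"
proof -
  note [measurable] = assms(2) L2_measurable[OF assms(1)]
  have ae: "AE t in M. (cmod (x t))\<^sup>2 = (cmod (y t))\<^sup>2"
    using assms(3) by eventually_elim simp
  have "integrable M (\<lambda>t. (cmod (y t))\<^sup>2)"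
    by (rule integrable_cong_AE_imp[OF L2_integrable_sq[OF assms(1)]]) (use ae in auto)
  then show "y \<in> L2_functions M" using assms(2) by (simp add: L2_functions_def)
  show "L2_sq M y = L2_sq M x"
    unfolding L2_sq_def by (rule integral_cong_AE) (use ae in auto)
qed

lemma L2_mult_integrable:
  assumes "x \<in> L2_functions M" "y \<in> L2_functions M"
  shows "integrable M (\<lambda>t. x t * y t)"
proof (rule Bochner_Integration.integrable_bound)
  note [measurable] = assms
  show "integrable M (\<lambda>t. (cmod (x t))\<^sup>2 + (cmod (y t))\<^sup>2)"
    using assms by (auto simp: L2_functions_def)
  show "(\<lambda>t. x t * y t) \<in> borel_measurable M" by measurable
  have "a * b \<le> a\<^sup>2 + b\<^sup>2" if "0 \<le> a" "0 \<le> b" for a b :: real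
    using zero_le_power2[of "a - b"] mult_nonneg_nonneg[OF that] unfolding power2_diff by linarith
  then show "AE t in M. norm (x t * y t) \<le> norm ((cmod (x t))\<^sup>2 + (cmod (y t))\<^sup>2)"
    by (simp add: norm_mult)
qed

lemma nn_integral_L2_sq:
  "x \<in> L2_functions M \<Longrightarrow> (\<integral>\<^sup>+t. (ennreal (cmod (x t)))\<^sup>2 \<partial>M) = ennreal (L2_sq M x)"
  unfolding L2_sq_def
  by (subst nn_integral_eq_integral[symmetric]) (auto simp: L2_functions_def ennreal_power)

text \<open>The product carries no conjugate, as suits the symmetric Fourier kernel; inner products
  are obtained by applying this to a conjugated factor.\<close>

lemma L2_Cauchy_Schwarz:
  assumes "x \<in> L2_functions M" "y \<in> L2_functions M"
  shows "cmod (LINT t|M. x t * y t) \<le> sqrt (L2_sq M x) * sqrt (L2_sq M y)"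
proof -
  note [measurable] = assms
  have i: "integrable M (\<lambda>t. cmod (x t * y t))"
    using L2_mult_integrable[OF assms] by simp
  have "ennreal ((LINT t|M. cmod (x t * y t))\<^sup>2) = (\<integral>\<^sup>+t. ennreal (cmod (x t)) * ennreal (cmod (y t)) \<partial>M)\<^sup>2"
    using i by (simp add: nn_integral_eq_integral[symmetric] ennreal_power[symmetric] ennreal_mult norm_mult)
  also have "\<dots> \<le> ennreal (L2_sq M x) * ennreal (L2_sq M y)"
    using Cauchy_Schwarz_nn_integral[of "\<lambda>t. ennreal (cmod (x t))" M "\<lambda>t. ennreal (cmod (y t))"] assms
    by (simp add: nn_integral_L2_sq)
  finally have "(LINT t|M. cmod (x t * y t))\<^sup>2 \<le> L2_sq M x * L2_sq M y"
    by (simp add: ennreal_mult[symmetric])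
  then have "(LINT t|M. cmod (x t * y t)) \<le> sqrt (L2_sq M x * L2_sq M y)"
    by (simp add: real_le_rsqrt)
  moreover have "cmod (LINT t|M. x t * y t) \<le> (LINT t|M. cmod (x t * y t))"
    by (rule integral_norm_bound)
  ultimately show ?thesis unfolding real_sqrt_mult by linarith
qed

section \<open>Mean-square convergence and completeness\<close>

lemma L2_tendsto_mult:
  assumes x: "L2_tendsto M f x" and y: "L2_tendsto M g y"
  shows "(\<lambda>n. LINT t|M. f n t * g n t) \<longlonglongrightarrow> (LINT t|M. x t * y t)"
proof -
  have L: "f n \<in> L2_functions M" "g n \<in> L2_functions M" "x \<in> L2_functions M" "y \<in> L2_functions M"
      "(\<lambda>t. f n t - x t) \<in> L2_functions M" "(\<lambda>t. g n t - y t) \<in> L2_functions M" for n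
    using assms by (auto simp: L2_tendsto_def intro!: L2_diff)
  let ?a = "\<lambda>n. sqrt (L2_sq M (\<lambda>t. f n t - x t))" and ?b = "\<lambda>n. sqrt (L2_sq M (\<lambda>t. g n t - y t))"
  have a: "?a \<longlonglongrightarrow> 0" and b: "?b \<longlonglongrightarrow> 0"
    using assms by (auto simp: L2_tendsto_def intro: tendsto_eq_intros)
  have "(\<lambda>n. (LINT t|M. f n t * g n t) - (LINT t|M. x t * y t)) \<longlonglongrightarrow> 0"
  proof (rule Lim_null_comparison)
    have "(LINT t|M. f n t * g n t) - (LINT t|M. x t * y t) =
        (LINT t|M. (f n t - x t) * (g n t - y t)) + (LINT t|M. (f n t - x t) * y t)
          + (LINT t|M. x t * (g n t - y t))" for n
      using L by (subst Bochner_Integration.integral_diff[symmetric]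
          Bochner_Integration.integral_add[symmetric];
          (intro L2_mult_integrable Bochner_Integration.integrable_add; simp)?)+
        (simp add: algebra_simps)
    then show "\<forall>\<^sub>F n in sequentially. norm ((LINT t|M. f n t * g n t) - (LINT t|M. x t * y t))
        \<le> ?a n * ?b n + ?a n * sqrt (L2_sq M y) + sqrt (L2_sq M x) * ?b n"
      using L by (auto intro!: eventuallyI order.trans[OF norm_triangle_ineq] add_mono L2_Cauchy_Schwarz)
    show "(\<lambda>n. ?a n * ?b n + ?a n * sqrt (L2_sq M y) + sqrt (L2_sq M x) * ?b n) \<longlonglongrightarrow> 0"
      by (rule tendsto_eq_intros a b refl | simp)+
  qed
  then show ?thesis by (simp add: LIM_zero_iff)
qed

lemma L2_tendsto_const: "y \<in> L2_functions M \<Longrightarrow> L2_tendsto M (\<lambda>_. y) y"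
  by (simp add: L2_tendsto_def L2_sq_def)

lemma L2_tendsto_cnj: "L2_tendsto M f y \<Longrightarrow> L2_tendsto M (\<lambda>n t. cnj (f n t)) (\<lambda>t. cnj (y t))"
  unfolding L2_tendsto_def
  by (auto intro: L2_cnj) (simp add: L2_sq_def complex_cnj_diff[symmetric] del: complex_cnj_diff)

lemma L2_tendsto_add:
  assumes "L2_tendsto M f x" "L2_tendsto M g y"
  shows "L2_tendsto M (\<lambda>n t. f n t + g n t) (\<lambda>t. x t + y t)"
proof -
  have L: "f n \<in> L2_functions M" "g n \<in> L2_functions M" "x \<in> L2_functions M" "y \<in> L2_functions M" for n
    using assms by (auto simp: L2_tendsto_def)
  have "(\<lambda>n. L2_sq M (\<lambda>t. f n t + g n t - (x t + y t))) \<longlonglongrightarrow> 0"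
  proof (rule tendsto_sandwich[OF _ _ tendsto_const])
    show "\<forall>\<^sub>F n in sequentially. L2_sq M (\<lambda>t. f n t + g n t - (x t + y t))
        \<le> 2 * L2_sq M (\<lambda>t. f n t - x t) + 2 * L2_sq M (\<lambda>t. g n t - y t)"
      unfolding add_diff_add by (intro always_eventually allI L2_add(2) L2_diff(1) L)
    show "(\<lambda>n. 2 * L2_sq M (\<lambda>t. f n t - x t) + 2 * L2_sq M (\<lambda>t. g n t - y t)) \<longlonglongrightarrow> 0"
      using assms by (auto simp: L2_tendsto_def intro!: tendsto_eq_intros)
  qed simp
  then show ?thesis using L by (auto simp: L2_tendsto_def intro!: L2_add)
qed

lemma L2_tendsto_cmult:
  assumes "L2_tendsto M f x"
  shows "L2_tendsto M (\<lambda>n t. c * f n t) (\<lambda>t. c * x t)"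
proof -
  have L: "f n \<in> L2_functions M" "x \<in> L2_functions M" for n
    using assms by (auto simp: L2_tendsto_def)
  have "L2_sq M (\<lambda>t. c * f n t - c * x t) = (cmod c)\<^sup>2 * L2_sq M (\<lambda>t. f n t - x t)" for n
    using L2_cmult(2)[OF L2_diff(1)[OF L]] by (simp add: right_diff_distrib)
  then show ?thesis
    using assms by (auto simp: L2_tendsto_def intro!: L2_cmult tendsto_mult_right_zero)
qed

lemma L2_tendsto_unique:
  assumes "L2_tendsto M f x" "L2_tendsto M f y"
  shows "AE t in M. x t = y t"
proof -
  \<comment> \<open>The sequence on the left is identically 0, so its mean-square distance to
    \<open>x - y\<close> is a constant tending to 0.\<close>
  have "L2_tendsto M (\<lambda>n t. f n t + (-1) * f n t) (\<lambda>t. x t + (-1) * y t)"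
    by (intro L2_tendsto_add L2_tendsto_cmult assms)
  then have *: "(\<lambda>t. x t - y t) \<in> L2_functions M" "L2_sq M (\<lambda>t. x t - y t) = 0"
    using L2_diff(1) assms by (auto simp: L2_tendsto_def L2_sq_def LIMSEQ_const_iff norm_minus_commute)
  show ?thesis using L2_sq_zero_imp_AE[OF *] by simp
qed

lemma L2_tendsto_cong_AE:
  assumes "L2_tendsto M f x" "y \<in> borel_measurable M" "AE t in M. x t = y t"
  shows "L2_tendsto M f y"
proof -
  have L: "f n \<in> L2_functions M" "x \<in> L2_functions M" for n
    using assms by (auto simp: L2_tendsto_def)
  have y: "y \<in> L2_functions M"
    using L2_cong_AE(1)[OF L(2) assms(2,3)] .
  have "L2_sq M (\<lambda>t. f n t - y t) = L2_sq M (\<lambda>t. f n t - x t)" for n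
    using L(1)[of n] assms(2,3) by (intro L2_cong_AE(2)[OF L2_diff(1)[OF L]]) auto
  then show ?thesis using assms(1) y by (simp add: L2_tendsto_def)
qed

text \<open>Riesz-Fischer: a rapidly converging subsequence converges pointwise almost everywhere,
  and Fatou's lemma carries the Cauchy estimate over to its limit.\<close>

lemma L2_complete:
  assumes f: "\<And>n. f n \<in> L2_functions M"
    and Cauchy: "\<And>e. e > 0 \<Longrightarrow> \<exists>N. \<forall>m\<ge>N. \<forall>n\<ge>N. L2_sq M (\<lambda>t. f m t - f n t) < e"
  obtains y where "L2_tendsto M f y"
proof -
  note [measurable] = f
  \<comment> \<open>The rate 1/8 leaves room for the weight 4^k: the weighted squares of the
    increments have integrals at most (1/2)^k, hence are bounded in k at almost every point. The
    increments themselves are then of order 2^(-k) there, and so summable.\<close>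
  have "\<exists>N. \<forall>m\<ge>N. \<forall>n\<ge>N. L2_sq M (\<lambda>t. f m t - f n t) < (1/8)^k" for k :: nat
    by (rule Cauchy) simp
  then obtain N where N: "\<And>k m n. m \<ge> N k \<Longrightarrow> n \<ge> N k \<Longrightarrow> L2_sq M (\<lambda>t. f m t - f n t) < (1/8)^k"
    by metis
  \<comment> \<open>Partial sums turn the thresholds \<open>N k\<close>, which need not increase,
    into a monotone sequence that dominates them.\<close>
  define r where "r = (\<lambda>k. \<Sum>i\<le>k. N i)"
  have rN: "r k \<ge> N k" for k unfolding r_def by (rule member_le_sum) auto
  have rS: "r (Suc k) \<ge> r k" for k by (simp add: r_def)
  let ?d = "\<lambda>k t. (cmod (f (r (Suc k)) t - f (r k) t))\<^sup>2"
  have d: "(\<integral>\<^sup>+t. ennreal (?d k t) \<partial>M) \<le> ennreal ((1/8)^k)" for k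
  proof -
    have "(\<integral>\<^sup>+t. ennreal (?d k t) \<partial>M) = ennreal (L2_sq M (\<lambda>t. f (r (Suc k)) t - f (r k) t))"
      by (subst nn_integral_L2_sq[symmetric]) (auto intro: L2_diff f simp: ennreal_power)
    also have "\<dots> \<le> ennreal ((1/8)^k)"
      using N[of k "r (Suc k)" "r k"] rN[of k] rS[of k] by (auto intro!: ennreal_leI)
    finally show ?thesis .
  qed
  have "(\<integral>\<^sup>+t. (\<Sum>k. ennreal (4^k * ?d k t)) \<partial>M) = (\<Sum>k. \<integral>\<^sup>+t. ennreal (4^k * ?d k t) \<partial>M)"
    by (rule nn_integral_suminf) measurable
  also have "\<dots> \<le> (\<Sum>k. ennreal ((1/2)^k))"
  proof (rule suminf_le)
    fix k
    have "(\<integral>\<^sup>+t. ennreal (4^k * ?d k t) \<partial>M) = ennreal (4^k) * (\<integral>\<^sup>+t. ennreal (?d k t) \<partial>M)"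
      by (simp add: ennreal_mult nn_integral_cmult)
    also have "\<dots> \<le> ennreal (4^k) * ennreal ((1/8)^k)"
      by (intro mult_left_mono d) auto
    also have "\<dots> = ennreal ((1/2)^k)"
      by (simp add: ennreal_mult[symmetric] power_mult_distrib[symmetric])
    finally show "(\<integral>\<^sup>+t. ennreal (4^k * ?d k t) \<partial>M) \<le> ennreal ((1/2)^k)" .
  qed auto
  also have "\<dots> = ennreal (\<Sum>k. (1/2)^k)"
    by (intro suminf_ennreal2 summable_geometric) auto
  also have "\<dots> < \<infinity>" by simp
  finally have "(\<integral>\<^sup>+t. (\<Sum>k. ennreal (4^k * ?d k t)) \<partial>M) \<noteq> \<infinity>" by simp
  then have "AE t in M. (\<Sum>k. ennreal (4^k * ?d k t)) \<noteq> \<infinity>"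
    by (intro nn_integral_PInf_AE) auto
  then have conv: "AE t in M. convergent (\<lambda>k. f (r k) t)"
  proof eventually_elim
    case (elim t)
    have "summable (\<lambda>k. 4^k * ?d k t)"
      using elim by (intro summable_suminf_not_top) auto
    then have "Bseq (\<lambda>k. 4^k * ?d k t)"
      by (intro convergent_imp_Bseq) (auto dest: summable_LIMSEQ_zero simp: convergent_def)
    then obtain C where "C > 0" and C: "\<And>k. norm (4^k * ?d k t) \<le> C" by (auto elim: BseqE)
    have four: "((2::real)^k)\<^sup>2 = 4^k" for k
      by (simp add: power2_eq_square flip: power_mult_distrib)
    have "cmod (f (r (Suc k)) t - f (r k) t) \<le> sqrt C * (1/2)^k" for k
    proof -
      have "(2^k * cmod (f (r (Suc k)) t - f (r k) t))\<^sup>2 \<le> C"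
        using C[of k] by (simp add: power_mult_distrib four)
      then have "2^k * cmod (f (r (Suc k)) t - f (r k) t) \<le> sqrt C" by (rule real_le_rsqrt)
      then show ?thesis by (simp add: field_simps)
    qed
    moreover have "summable (\<lambda>k. sqrt C * (1/2)^k)"
      by (rule summable_mult[OF summable_geometric]) simp
    ultimately have "summable (\<lambda>k. f (r (Suc k)) t - f (r k) t)"
      by (meson summable_comparison_test')
    then have "convergent (\<lambda>n. \<Sum>k<n. f (r (Suc k)) t - f (r k) t)"
      by (simp add: summable_iff_convergent)
    then have "convergent (\<lambda>n. f (r n) t - f (r 0) t)"
      by (subst (asm) sum_lessThan_telescope)
    then show ?case by (simp add: convergent_diff_const_right_iff)
  qed
  define y where "y = (\<lambda>t. lim (\<lambda>k. f (r k) t))"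
  have y [measurable]: "y \<in> borel_measurable M"
    unfolding y_def by measurable
  \<comment> \<open>Fatou's lemma is applied along the subsequence with \<open>n\<close> fixed, so
    the estimate holds for the whole sequence and not only along \<open>r\<close>.\<close>
  have bound: "(\<integral>\<^sup>+t. (ennreal (cmod (f n t - y t)))\<^sup>2 \<partial>M) \<le> ennreal ((1/8)^k)" if "n \<ge> N k" for n k
  proof -
    have "(\<integral>\<^sup>+t. (ennreal (cmod (f n t - y t)))\<^sup>2 \<partial>M) =
        (\<integral>\<^sup>+t. liminf (\<lambda>j. (ennreal (cmod (f n t - f (r j) t)))\<^sup>2) \<partial>M)"
    proof (rule nn_integral_cong_AE, use conv in eventually_elim)
      case (elim t)
      then have "(\<lambda>j. f (r j) t) \<longlonglongrightarrow> y t"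
        by (simp add: y_def convergent_LIMSEQ_iff)
      then have "(\<lambda>j. ennreal ((cmod (f n t - f (r j) t))\<^sup>2)) \<longlonglongrightarrow> ennreal ((cmod (f n t - y t))\<^sup>2)"
        by (intro tendsto_intros)
      then show ?case
        unfolding ennreal_power[OF norm_ge_zero] by (rule lim_imp_Liminf[OF sequentially_bot, symmetric])
    qed
    also have "\<dots> \<le> liminf (\<lambda>j. \<integral>\<^sup>+t. (ennreal (cmod (f n t - f (r j) t)))\<^sup>2 \<partial>M)"
      by (rule nn_integral_liminf) measurable
    also have "\<dots> = liminf (\<lambda>j. ennreal (L2_sq M (\<lambda>t. f n t - f (r j) t)))"
      by (simp add: nn_integral_L2_sq L2_diff f)
    also have "\<dots> \<le> limsup (\<lambda>j. ennreal (L2_sq M (\<lambda>t. f n t - f (r j) t)))"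
      by (rule Liminf_le_Limsup) simp
    also have "\<dots> \<le> ennreal ((1/8)^k)"
    proof (rule Limsup_bounded, rule eventually_sequentiallyI)
      fix j assume "k \<le> j"
      then have "r k \<le> r j" using lift_Suc_mono_le[of r k j] rS by blast
      then show "ennreal (L2_sq M (\<lambda>t. f n t - f (r j) t)) \<le> ennreal ((1/8)^k)"
        using N[of k n "r j"] rN[of k] that by (auto intro!: ennreal_leI)
    qed
    finally show ?thesis .
  qed
  have diff: "(\<lambda>t. f n t - y t) \<in> L2_functions M" if "n \<ge> N k" for n k
  proof -
    have "integrable M (\<lambda>t. (cmod (f n t - y t))\<^sup>2)"
      using bound[OF that]
      by (intro integrableI_bounded) (auto simp: ennreal_power intro: le_less_trans[OF _ ennreal_less_top])
    then show ?thesis by (simp add: L2_functions_def)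
  qed
  have "(\<lambda>t. f (N 0) t - (f (N 0) t - y t)) \<in> L2_functions M"
    by (rule L2_diff(1)[OF f diff[OF order_refl]])
  then have yL: "y \<in> L2_functions M" by simp
  have "(\<lambda>n. L2_sq M (\<lambda>t. f n t - y t)) \<longlonglongrightarrow> 0"
  proof (rule LIMSEQ_I)
    fix e :: real assume "e > 0"
    then obtain k where k: "(1/8 :: real)^k < e" using real_arch_pow_inv[of e "1/8"] by auto
    have "norm (L2_sq M (\<lambda>t. f n t - y t) - 0) < e" if "n \<ge> N k" for n
      using bound[OF that] nn_integral_L2_sq[OF diff[OF that]] k by simp
    then show "\<exists>no. \<forall>n\<ge>no. norm (L2_sq M (\<lambda>t. f n t - y t) - 0) < e" by blast
  qed
  then have "L2_tendsto M f y" using f yL by (simp add: L2_tendsto_def)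
  then show ?thesis by (rule that)
qed

section \<open>The Fourier integral\<close>

text \<open>Fubini's theorem is used on the completed measure itself, since the functions in play
  are only Lebesgue measurable. A countable cover by Borel sets of finite measure serves for the
  completion too.\<close>

lemma sigma_finite_lebesgue: "sigma_finite_measure lebesgue"
proof -
  obtain A :: "'a set set" where "countable A" "A \<subseteq> sets lborel" "\<Union>A = space lborel"
      "\<forall>a\<in>A. emeasure lborel a \<noteq> \<infinity>"
    using sigma_finite_measure.sigma_finite_countable[OF sigma_finite_lborel] by blast
  then show ?thesis
    by (intro sigma_finite_measure.intro exI[of _ A]) auto
qed

interpretation lebesgue: sigma_finite_measure "lebesgue :: real measure"
  by (rule sigma_finite_lebesgue)

interpretation lebesgue_pair: pair_sigma_finite "lebesgue :: real measure" "lebesgue :: real measure" ..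

lemma measurable_ident_lebesgue [measurable]: "(\<lambda>t::real. t) \<in> borel_measurable lebesgue"
  by (rule measurable_completion) simp

lemma measurable_fst_lebesgue [measurable]:
  "fst \<in> borel_measurable ((lebesgue :: real measure) \<Otimes>\<^sub>M M)"
  using measurable_compose[OF measurable_fst measurable_ident_lebesgue] by (simp add: comp_def)

lemma measurable_snd_lebesgue [measurable]:
  "snd \<in> borel_measurable (M \<Otimes>\<^sub>M (lebesgue :: real measure))"
  using measurable_compose[OF measurable_snd measurable_ident_lebesgue] by (simp add: comp_def)

abbreviation fourier :: "(real \<Rightarrow> complex) \<Rightarrow> real \<Rightarrow> complex" where
  "fourier \<equiv> fourier_integral UNIV"

lemma fourier_def:
  "fourier x t =
    1 / complex_of_real (sqrt (2 * pi)) * (LINT \<xi>|lebesgue. exp (\<i> * complex_of_real (t * \<xi>)) * x \<xi>)"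
  by (simp add: fourier_integral_def lebesgue_on_UNIV_eq)

lemma norm_fourier_const: "cmod (1 / complex_of_real (sqrt (2 * pi))) = 1 / sqrt (2 * pi)"
  by (simp add: norm_divide)

lemma fourier_const_square: "1 / complex_of_real (sqrt (2 * pi)) * (1 / complex_of_real (sqrt (2 * pi)))
    = 1 / complex_of_real (2 * pi)"
proof -
  have "complex_of_real (sqrt (2 * pi)) * complex_of_real (sqrt (2 * pi)) = complex_of_real (2 * pi)"
    by (simp flip: of_real_mult)
  then show ?thesis by simp
qed

lemma integrable_iexp_mult:
  assumes "integrable lebesgue x"
  shows "integrable lebesgue (\<lambda>\<xi>. exp (\<i> * complex_of_real (t * \<xi>)) * x \<xi>)"
proof (rule Bochner_Integration.integrable_bound[OF assms])
  have [measurable]: "x \<in> borel_measurable lebesgue" using assms by auto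
  show "(\<lambda>\<xi>. exp (\<i> * complex_of_real (t * \<xi>)) * x \<xi>) \<in> borel_measurable lebesgue" by measurable
qed (simp add: norm_mult)

lemma borel_measurable_fourier [measurable]:
  assumes [measurable]: "x \<in> borel_measurable lebesgue"
  shows "fourier x \<in> borel_measurable lebesgue"
  unfolding fourier_def[abs_def] by measurable

lemma norm_fourier_le: "cmod (fourier x t) \<le> (LINT \<xi>|lebesgue. cmod (x \<xi>))"
proof -
  have "cmod (fourier x t) \<le> 1 / sqrt (2 * pi) * (LINT \<xi>|lebesgue. cmod (x \<xi>))"
    unfolding fourier_def norm_mult norm_fourier_const
    using integral_norm_bound[of lebesgue "\<lambda>\<xi>. exp (\<i> * complex_of_real (t * \<xi>)) * x \<xi>"]
    by (intro mult_left_mono) (auto simp: norm_mult)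
  also have "\<dots> \<le> 1 * (LINT \<xi>|lebesgue. cmod (x \<xi>))"
    using pi_ge_two by (intro mult_right_mono) (auto simp: real_le_rsqrt)
  finally show ?thesis by simp
qed

lemma fourier_add:
  assumes "integrable lebesgue x" "integrable lebesgue y"
  shows "fourier (\<lambda>t. x t + y t) t = fourier x t + fourier y t"
  using integrable_iexp_mult[OF assms(1), of t] integrable_iexp_mult[OF assms(2), of t]
  by (simp add: fourier_def distrib_left add_divide_distrib)

lemma fourier_cmult: "fourier (\<lambda>t. c * x t) t = c * fourier x t"
  by (simp add: fourier_def mult.left_commute)

lemma fourier_diff:
  assumes "integrable lebesgue x" "integrable lebesgue y"
  shows "fourier (\<lambda>t. x t - y t) = (\<lambda>t. fourier x t - fourier y t)"
  using integrable_iexp_mult[OF assms(1)] integrable_iexp_mult[OF assms(2)]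
  by (simp add: fun_eq_iff fourier_def right_diff_distrib diff_divide_distrib)

lemma fourier_cnj: "fourier (\<lambda>t. cnj (x t)) t = cnj (fourier x (- t))"
proof -
  have "cnj (LINT \<xi>|lebesgue. exp (\<i> * complex_of_real (- t * \<xi>)) * x \<xi>) =
      (LINT \<xi>|lebesgue. cnj (exp (\<i> * complex_of_real (- t * \<xi>)) * x \<xi>))"
    by (simp del: complex_cnj_mult)
  then show ?thesis by (simp add: fourier_def exp_cnj)
qed

lemma fourier_reflect: "fourier (\<lambda>t. x (- t)) t = fourier x (- t)"
  using lebesgue_integral_real_affine[of "-1" "\<lambda>\<xi>. exp (\<i> * complex_of_real (t * \<xi>)) * x (- \<xi>)" 0]
  by (simp add: fourier_def)

text \<open>Fubini's theorem and the symmetry of the kernel in t and \<xi>. The kernel has modulus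
  1, so integrability of both factors makes the double integral absolutely convergent.\<close>

lemma fourier_pairing:
  assumes x: "integrable lebesgue x" and w: "integrable lebesgue w"
  shows "(LINT t|lebesgue. fourier x t * w t) = (LINT \<xi>|lebesgue. x \<xi> * fourier w \<xi>)"
proof -
  let ?c = "1 / complex_of_real (sqrt (2 * pi))"
  let ?k = "\<lambda>t \<xi>. exp (\<i> * complex_of_real (t * \<xi>)) * x \<xi> * w t"
  have [measurable]: "x \<in> borel_measurable lebesgue" "w \<in> borel_measurable lebesgue"
    using assms by auto
  have int: "integrable (lebesgue \<Otimes>\<^sub>M lebesgue) (case_prod ?k)"
  proof (rule lebesgue_pair.Fubini_integrable)
    show "case_prod ?k \<in> borel_measurable (lebesgue \<Otimes>\<^sub>M lebesgue)" by measurable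
    show "integrable lebesgue (\<lambda>t. LINT \<xi>|lebesgue. cmod (case (t, \<xi>) of (t, \<xi>) \<Rightarrow> ?k t \<xi>))"
      using w by (simp add: norm_mult)
    show "AE t in lebesgue. integrable lebesgue (\<lambda>\<xi>. case (t, \<xi>) of (t, \<xi>) \<Rightarrow> ?k t \<xi>)"
      using integrable_iexp_mult[OF x] by simp
  qed
  have "(LINT t|lebesgue. fourier x t * w t) = (LINT t|lebesgue. LINT \<xi>|lebesgue. ?c * ?k t \<xi>)"
    by (simp add: fourier_def)
  also have "\<dots> = ?c * (LINT t|lebesgue. LINT \<xi>|lebesgue. ?k t \<xi>)"
    by (simp only: integral_mult_right_zero)
  also have "\<dots> = ?c * (LINT \<xi>|lebesgue. LINT t|lebesgue. ?k t \<xi>)"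
    using lebesgue_pair.Fubini_integral[OF int] by simp
  also have "\<dots> = (LINT \<xi>|lebesgue. LINT t|lebesgue. ?c * ?k t \<xi>)"
    by (simp only: integral_mult_right_zero)
  also have "\<dots> = (LINT \<xi>|lebesgue. LINT t|lebesgue. (x \<xi> * ?c) * (exp (\<i> * complex_of_real (\<xi> * t)) * w t))"
    by (simp add: mult_ac)
  also have "\<dots> = (LINT \<xi>|lebesgue. x \<xi> * fourier w \<xi>)"
    by (simp only: integral_mult_right_zero fourier_def mult.assoc)
  finally show ?thesis .
qed

section \<open>Gaussian regularisation\<close>

lemma integrable_gaussian:
  assumes "\<sigma> > 0"
  shows "integrable lebesgue (\<lambda>t::real. exp (- (\<sigma> * t)\<^sup>2 / 2))"
proof -
  have "integrable lborel (\<lambda>t. std_normal_density (0 + \<sigma> * t))"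
    using assms by (intro lborel_integrable_real_affine) auto
  then have "integrable lborel (\<lambda>t. sqrt (2 * pi) * std_normal_density (0 + \<sigma> * t))"
    by (intro integrable_mult_right)
  then have "integrable lborel (\<lambda>t::real. exp (- (\<sigma> * t)\<^sup>2 / 2))"
    by (simp add: std_normal_density_def)
  then show ?thesis by (simp add: integrable_completion)
qed

text \<open>The integral is the characteristic function of the standard normal distribution at
  \<open>h / \<sigma>\<close>, after the substitution \<open>s = \<sigma> * t\<close>. Writing the
  result as a normal density prepares for a smoothing kernel of mass 1.\<close>

lemma integral_iexp_gaussian:
  assumes "\<sigma> > 0"
  shows "(LINT t|lebesgue. exp (\<i> * complex_of_real (h * t)) * complex_of_real (exp (- (\<sigma> * t)\<^sup>2 / 2)))
    = complex_of_real (2 * pi * normal_density 0 \<sigma> h)"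
proof -
  let ?h = "h / \<sigma>"
  have "complex_of_real (exp (- ?h\<^sup>2 / 2)) = (CLINT s|std_normal_distribution. iexp (?h * s))"
    using fun_cong[OF char_std_normal_distribution, of ?h] by (simp add: char_def)
  also have "\<dots> = (LINT s|lborel. std_normal_density s *\<^sub>R iexp (?h * s))"
    by (subst integral_density) auto
  also have "\<dots> = \<sigma> *\<^sub>R (LINT t|lborel. std_normal_density (0 + \<sigma> * t) *\<^sub>R iexp (?h * (0 + \<sigma> * t)))"
    using assms by (subst lborel_integral_real_affine[where c=\<sigma> and t=0]) auto
  also have "\<dots> = \<sigma> *\<^sub>R (LINT t|lborel. complex_of_real (1 / sqrt (2 * pi)) *
      (exp (\<i> * complex_of_real (h * t)) * complex_of_real (exp (- (\<sigma> * t)\<^sup>2 / 2))))"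
    using assms by (simp add: std_normal_density_def scaleR_conv_of_real mult_ac)
  also have "\<dots> = complex_of_real (\<sigma> / sqrt (2 * pi)) *
      (LINT t|lebesgue. exp (\<i> * complex_of_real (h * t)) * complex_of_real (exp (- (\<sigma> * t)\<^sup>2 / 2)))"
    by (simp add: integral_completion scaleR_conv_of_real)
  finally have "(LINT t|lebesgue. exp (\<i> * complex_of_real (h * t)) * complex_of_real (exp (- (\<sigma> * t)\<^sup>2 / 2)))
      = complex_of_real (sqrt (2 * pi) / \<sigma> * exp (- ?h\<^sup>2 / 2))"
    using assms by (simp add: field_simps)
  also have "sqrt (2 * pi) / \<sigma> * exp (- ?h\<^sup>2 / 2) = 2 * pi * normal_density 0 \<sigma> h"
  proof -
    have "sqrt (2 * pi) / \<sigma> = 2 * pi * (1 / sqrt (2 * pi * \<sigma>\<^sup>2))"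
      using assms by (simp add: real_sqrt_mult field_simps)
    then show ?thesis by (simp add: normal_density_def power_divide)
  qed
  finally show ?thesis .
qed

lemma fourier_bounded_mult_integrable:
  assumes x: "integrable lebesgue x" and w: "integrable lebesgue w"
  shows "integrable lebesgue (\<lambda>t. fourier x t * w t)"
proof (rule Bochner_Integration.integrable_bound)
  have [measurable]: "x \<in> borel_measurable lebesgue" "w \<in> borel_measurable lebesgue"
    using assms by auto
  show "integrable lebesgue (\<lambda>t. (LINT \<xi>|lebesgue. cmod (x \<xi>)) * cmod (w t))"
    using w by (intro integrable_mult_right) auto
  show "(\<lambda>t. fourier x t * w t) \<in> borel_measurable lebesgue" by measurable
  show "AE t in lebesgue. norm (fourier x t * w t) \<le> norm ((LINT \<xi>|lebesgue. cmod (x \<xi>)) * cmod (w t))"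
    by (auto simp: norm_mult intro!: mult_right_mono norm_fourier_le)
qed

text \<open>The Gaussian makes the second factor on the left integrable, so the pairing identity
  applies to it; its transform is the conjugate of \<open>z\<close> smoothed by a normal density of
  deviation \<sigma>. Letting \<sigma> tend to 0 gives Parseval's formula formally.\<close>

lemma regularised_parseval:
  assumes x: "integrable lebesgue x" and z: "integrable lebesgue z" and \<sigma>: "\<sigma> > 0"
  shows "(LINT t|lebesgue. fourier x t * (cnj (fourier z t) * complex_of_real (exp (- (\<sigma> * t)\<^sup>2 / 2))))
    = (LINT a|lebesgue. x a * cnj (LINT b|lebesgue. z b * complex_of_real (normal_density a \<sigma> b)))"
proof -
  let ?c = "1 / complex_of_real (sqrt (2 * pi))"
  let ?\<gamma> = "\<lambda>t. complex_of_real (exp (- (\<sigma> * t)\<^sup>2 / 2))"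
  let ?w = "\<lambda>t. cnj (fourier z t) * ?\<gamma> t"
  have \<gamma>: "integrable lebesgue ?\<gamma>"
    using integrable_gaussian[OF \<sigma>] by (rule integrable_of_real)
  have w: "integrable lebesgue ?w"
    using integrable_cnj[OF fourier_bounded_mult_integrable[OF z \<gamma>]] by simp
  have fw: "cnj (fourier ?w a) = (LINT b|lebesgue. z b * complex_of_real (normal_density a \<sigma> b))" for a
  proof -
    \<comment> \<open>A modulated Gaussian: the factor with frequency \<open>- a\<close> translates
      its transform by \<open>a\<close>, which centres the normal density at
      \<open>a\<close>.\<close>
    let ?u = "\<lambda>t. exp (\<i> * complex_of_real (- a * t)) * ?\<gamma> t"
    have fu: "fourier ?u b = ?c * complex_of_real (2 * pi * normal_density 0 \<sigma> (b - a))" for b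
    proof -
      have "\<i> * complex_of_real ((b - a) * t) = \<i> * complex_of_real (b * t) + \<i> * complex_of_real (- a * t)" for t
        by (simp add: algebra_simps)
      then have e: "exp (\<i> * complex_of_real (b * t)) * ?u t = exp (\<i> * complex_of_real ((b - a) * t)) * ?\<gamma> t" for t
        by (simp only: exp_add mult.assoc)
      have "fourier ?u b = ?c * (LINT t|lebesgue. exp (\<i> * complex_of_real ((b - a) * t)) * ?\<gamma> t)"
        unfolding fourier_def e ..
      then show ?thesis by (simp only: integral_iexp_gaussian[OF \<sigma>])
    qed
    have scale: "z b * (c * complex_of_real (p * n)) = c * complex_of_real p * (z b * complex_of_real n)" for b c p n
      by simp
    have "cnj (fourier ?w a) = ?c * (LINT t|lebesgue. cnj (exp (\<i> * complex_of_real (a * t)) * ?w t))"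
      unfolding Bochner_Integration.integral_cnj fourier_def[of ?w] by simp
    also have "\<dots> = ?c * (LINT t|lebesgue. fourier z t * ?u t)"
      by (simp add: exp_cnj mult_ac)
    also have "\<dots> = ?c * (LINT b|lebesgue. z b * fourier ?u b)"
      using fourier_pairing[OF z integrable_iexp_mult[OF \<gamma>, of "- a"]] by simp
    also have "\<dots> = ?c * (LINT b|lebesgue. z b * (?c * complex_of_real (2 * pi * normal_density 0 \<sigma> (b - a))))"
      by (simp only: fu)
    also have "\<dots> =
        (?c * ?c * complex_of_real (2 * pi)) * (LINT b|lebesgue. z b * complex_of_real (normal_density 0 \<sigma> (b - a)))"
      by (simp only: scale[where p="2 * pi"] integral_mult_right_zero mult.assoc[where 'a=complex])
    \<comment> \<open>The two normalising factors \<open>?c\<close> multiply to 1/(2 pi), which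
      cancels the 2 pi from the Gaussian integral.\<close>
    also have "\<dots> = (LINT b|lebesgue. z b * complex_of_real (normal_density a \<sigma> b))"
      unfolding fourier_const_square by (simp add: normal_density_def)
    finally show ?thesis .
  qed
  have "fourier ?w a = cnj (LINT b|lebesgue. z b * complex_of_real (normal_density a \<sigma> b))" for a
    by (simp only: fw[symmetric] complex_cnj_cnj)
  then show ?thesis
    using fourier_pairing[OF x w] by simp
qed

text \<open>Integrability is not assumed: where it fails, the left side is 0 by default. Estimates
  can thus move to nonnegative integrals at once.\<close>

lemma norm_integral_le_nn_integral:
  fixes f :: "'a \<Rightarrow> 'b::{banach, second_countable_topology}"
  shows "ennreal (norm (integral\<^sup>L M f)) \<le> (\<integral>\<^sup>+t. ennreal (norm (f t)) \<partial>M)"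
  by (cases "integrable M f") (simp_all add: integral_norm_bound_ennreal not_integrable_integral_eq)

lemma normal_density_commute: "normal_density a \<sigma> b = normal_density b \<sigma> a"
  by (simp add: normal_density_def power2_commute)

lemma nn_integral_normal_density:
  assumes "\<sigma> > 0"
  shows "(\<integral>\<^sup>+b. ennreal (normal_density a \<sigma> b) \<partial>lebesgue) = 1"
proof -
  interpret prob_space "density lborel (normal_density a \<sigma>)"
    by (rule prob_space_normal_density) fact
  show ?thesis
    using emeasure_space_1 by (simp add: nn_integral_completion emeasure_density)
qed

lemma borel_measurable_normal_density_pair [measurable]:
  "(\<lambda>p. normal_density (fst p) \<sigma> (snd p)) \<in> borel_measurable ((lebesgue :: real measure) \<Otimes>\<^sub>M (lebesgue :: real measure))"
  unfolding normal_density_def by measurable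

text \<open>By the inequality of arithmetic and geometric means, smoothing with the Gaussian kernel,
  whose mass is \<open>1\<close> in each variable, does not increase the quadratic form.\<close>

lemma gaussian_form_le:
  assumes x: "x \<in> L2_functions lebesgue" and \<sigma>: "\<sigma> > 0"
  shows "cmod (LINT a|lebesgue. x a * cnj (LINT b|lebesgue. x b * complex_of_real (normal_density a \<sigma> b)))
    \<le> L2_sq lebesgue x"
    (is "cmod ?I \<le> _")
proof -
  have [measurable]: "x \<in> borel_measurable lebesgue"
    using x by (rule L2_measurable)
  let ?n = "\<lambda>a b. ennreal (normal_density a \<sigma> b)"
  let ?x = "\<lambda>a. ennreal (cmod (x a))"
  have m [measurable]: "(\<lambda>b. ?n a b) \<in> borel_measurable lebesgue" for a
    by (intro measurable_compose[OF _ measurable_ennreal] measurable_completion) simp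
  have S: "(\<integral>\<^sup>+a. (?x a)\<^sup>2 \<partial>lebesgue) = ennreal (L2_sq lebesgue x)"
    by (rule nn_integral_L2_sq[OF x])
  have "ennreal (cmod ?I) \<le>
      (\<integral>\<^sup>+a. ennreal (cmod (x a * cnj (LINT b|lebesgue. x b * complex_of_real (normal_density a \<sigma> b)))) \<partial>lebesgue)"
    by (rule norm_integral_le_nn_integral)
  also have "\<dots> \<le> (\<integral>\<^sup>+a. ?x a * (\<integral>\<^sup>+b. ?x b * ?n a b \<partial>lebesgue) \<partial>lebesgue)"
  proof (rule nn_integral_mono)
    fix a
    have "ennreal (cmod (LINT b|lebesgue. x b * complex_of_real (normal_density a \<sigma> b)))
        \<le> (\<integral>\<^sup>+b. ?x b * ?n a b \<partial>lebesgue)"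
      using norm_integral_le_nn_integral[of lebesgue "\<lambda>b. x b * complex_of_real (normal_density a \<sigma> b)"]
      by (simp add: norm_mult ennreal_mult)
    then show "ennreal (cmod (x a * cnj (LINT b|lebesgue. x b * complex_of_real (normal_density a \<sigma> b))))
        \<le> ?x a * (\<integral>\<^sup>+b. ?x b * ?n a b \<partial>lebesgue)"
      unfolding norm_mult complex_mod_cnj by (simp add: ennreal_mult mult_left_mono)
  qed
  also have "\<dots> = (\<integral>\<^sup>+a. (\<integral>\<^sup>+b. ?x a * (?x b * ?n a b) \<partial>lebesgue) \<partial>lebesgue)"
    using m by (subst nn_integral_cmult) auto
  \<comment> \<open>Doubling allows 2ab \<le> a^2 + b^2 to be used without division among extended
    nonnegative reals.\<close>
  finally have "2 * ennreal (cmod ?I) \<le> 2 * (\<integral>\<^sup>+a. (\<integral>\<^sup>+b. ?x a * (?x b * ?n a b) \<partial>lebesgue) \<partial>lebesgue)"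
    by (intro mult_left_mono) auto
  also have "\<dots> = (\<integral>\<^sup>+a. (\<integral>\<^sup>+b. 2 * (?x a * (?x b * ?n a b)) \<partial>lebesgue) \<partial>lebesgue)"
    by (subst nn_integral_cmult[symmetric], measurable) (simp add: nn_integral_cmult)
  also have "\<dots> \<le> (\<integral>\<^sup>+a. (\<integral>\<^sup>+b. (?x a)\<^sup>2 * ?n a b + (?x b)\<^sup>2 * ?n a b \<partial>lebesgue) \<partial>lebesgue)"
  proof (intro nn_integral_mono)
    fix a b
    have "2 * ?x a * ?x b * ?n a b \<le> ((?x a)\<^sup>2 + (?x b)\<^sup>2) * ?n a b"
      by (intro mult_right_mono sum_of_squares_ge_ennreal) auto
    then show "2 * (?x a * (?x b * ?n a b)) \<le> (?x a)\<^sup>2 * ?n a b + (?x b)\<^sup>2 * ?n a b"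
      by (simp add: distrib_right mult.assoc)
  qed
  also have "\<dots> = (\<integral>\<^sup>+a. (\<integral>\<^sup>+b. (?x a)\<^sup>2 * ?n a b \<partial>lebesgue) \<partial>lebesgue)
      + (\<integral>\<^sup>+a. (\<integral>\<^sup>+b. (?x b)\<^sup>2 * ?n a b \<partial>lebesgue) \<partial>lebesgue)"
    using m by (subst nn_integral_add; (subst nn_integral_add)?; simp)
  also have "(\<integral>\<^sup>+a. (\<integral>\<^sup>+b. (?x a)\<^sup>2 * ?n a b \<partial>lebesgue) \<partial>lebesgue) = ennreal (L2_sq lebesgue x)"
    using m \<sigma> by (simp add: nn_integral_cmult nn_integral_normal_density S)
  \<comment> \<open>Here the square sits on the inner variable; exchanging the integrals and the
    symmetry of the density reduce this term to the previous one.\<close>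
  also have "(\<integral>\<^sup>+a. (\<integral>\<^sup>+b. (?x b)\<^sup>2 * ?n a b \<partial>lebesgue) \<partial>lebesgue) =
      (\<integral>\<^sup>+b. (\<integral>\<^sup>+a. (?x b)\<^sup>2 * ?n b a \<partial>lebesgue) \<partial>lebesgue)"
    by (subst lebesgue_pair.Fubini') (auto simp: normal_density_commute)
  also have "\<dots> = ennreal (L2_sq lebesgue x)"
    using m \<sigma> by (simp add: nn_integral_cmult nn_integral_normal_density S)
  finally have "ennreal (cmod ?I) + ennreal (cmod ?I) \<le> ennreal (L2_sq lebesgue x) + ennreal (L2_sq lebesgue x)"
    by (simp only: mult_2)
  then have "ennreal (cmod ?I + cmod ?I) \<le> ennreal (L2_sq lebesgue x + L2_sq lebesgue x)"
    by (simp only: ennreal_plus norm_ge_zero L2_sq_nonneg)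
  then have "cmod ?I + cmod ?I \<le> L2_sq lebesgue x + L2_sq lebesgue x"
    by (subst (asm) ennreal_le_iff) auto
  then show ?thesis by linarith
qed

text \<open>With both functions equal to \<open>x\<close>, the left side of the regularised formula
  is the integral of the squared modulus of \<open>fourier x\<close> against a Gaussian, and
  \<open>gaussian_form_le\<close> bounds it uniformly in the width. Fatou's lemma then removes the
  Gaussian, at the price of giving an inequality only.\<close>

lemma fourier_L2_contraction:
  assumes x: "x \<in> L2_functions lebesgue" and x1: "integrable lebesgue x"
  shows "fourier x \<in> L2_functions lebesgue" and "L2_sq lebesgue (fourier x) \<le> L2_sq lebesgue x"
proof -
  note [measurable] = x
  define s where "s n = 1 / real (Suc n)" for n
  have s: "s n > 0" for n by (simp add: s_def)
  have s0: "s \<longlonglongrightarrow> 0" unfolding s_def using LIMSEQ_Suc[OF lim_const_over_n[of 1]] by simp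
  let ?\<gamma> = "\<lambda>n t. exp (- (s n * t)\<^sup>2 / 2)"
  have le: "(\<integral>\<^sup>+t. ennreal ((cmod (fourier x t))\<^sup>2 * ?\<gamma> n t) \<partial>lebesgue) \<le> ennreal (L2_sq lebesgue x)" for n
  proof -
    have \<gamma>: "integrable lebesgue (\<lambda>t. complex_of_real (?\<gamma> n t))"
      using integrable_gaussian[OF s] by (rule integrable_of_real)
    have "integrable lebesgue (\<lambda>t. cnj (fourier x t) * complex_of_real (?\<gamma> n t))"
      using integrable_cnj[OF fourier_bounded_mult_integrable[OF x1 \<gamma>]] by simp
    then have i: "integrable lebesgue (\<lambda>t. fourier x t * (cnj (fourier x t) * complex_of_real (?\<gamma> n t)))"
      by (rule fourier_bounded_mult_integrable[OF x1])
    have eq: "fourier x t * (cnj (fourier x t) * complex_of_real (?\<gamma> n t))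
        = complex_of_real ((cmod (fourier x t))\<^sup>2 * ?\<gamma> n t)" for t
      unfolding mult.assoc[symmetric] complex_norm_square[symmetric] by simp
    have i': "integrable lebesgue (\<lambda>t. (cmod (fourier x t))\<^sup>2 * ?\<gamma> n t)"
      using i unfolding eq complex_of_real_integrable_eq .
    have "complex_of_real (LINT t|lebesgue. (cmod (fourier x t))\<^sup>2 * ?\<gamma> n t) =
        (LINT a|lebesgue. x a * cnj (LINT b|lebesgue. x b * complex_of_real (normal_density a (s n) b)))"
      using regularised_parseval[OF x1 x1 s[of n]] unfolding eq integral_complex_of_real .
    then have "cmod (complex_of_real (LINT t|lebesgue. (cmod (fourier x t))\<^sup>2 * ?\<gamma> n t)) \<le> L2_sq lebesgue x"
      using gaussian_form_le[OF x s] by simp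
    then have "(LINT t|lebesgue. (cmod (fourier x t))\<^sup>2 * ?\<gamma> n t) \<le> L2_sq lebesgue x"
      by simp
    then show ?thesis by (subst nn_integral_eq_integral[OF i']) (auto intro: ennreal_leI)
  qed
  have "(\<integral>\<^sup>+t. ennreal ((cmod (fourier x t))\<^sup>2) \<partial>lebesgue) =
      (\<integral>\<^sup>+t. liminf (\<lambda>n. ennreal ((cmod (fourier x t))\<^sup>2 * ?\<gamma> n t)) \<partial>lebesgue)"
  proof (rule nn_integral_cong)
    fix t
    have "(\<lambda>n. ennreal ((cmod (fourier x t))\<^sup>2 * ?\<gamma> n t)) \<longlonglongrightarrow> ennreal ((cmod (fourier x t))\<^sup>2 * exp (- (0 * t)\<^sup>2 / 2))"
      by (intro tendsto_intros s0) simp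
    then show "ennreal ((cmod (fourier x t))\<^sup>2) = liminf (\<lambda>n. ennreal ((cmod (fourier x t))\<^sup>2 * ?\<gamma> n t))"
      using lim_imp_Liminf[OF sequentially_bot] by fastforce
  qed
  also have "\<dots> \<le> liminf (\<lambda>n. \<integral>\<^sup>+t. ennreal ((cmod (fourier x t))\<^sup>2 * ?\<gamma> n t) \<partial>lebesgue)"
    by (rule nn_integral_liminf) measurable
  also have "\<dots> \<le> limsup (\<lambda>n. \<integral>\<^sup>+t. ennreal ((cmod (fourier x t))\<^sup>2 * ?\<gamma> n t) \<partial>lebesgue)"
    by (rule Liminf_le_Limsup) simp
  also have "\<dots> \<le> ennreal (L2_sq lebesgue x)"
    by (intro Limsup_bounded always_eventually allI le)
  finally have *: "(\<integral>\<^sup>+t. ennreal ((cmod (fourier x t))\<^sup>2) \<partial>lebesgue) \<le> ennreal (L2_sq lebesgue x)" .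
  then have "integrable lebesgue (\<lambda>t. (cmod (fourier x t))\<^sup>2)"
    by (intro integrableI_bounded) (auto intro: le_less_trans[OF _ ennreal_less_top])
  then show "fourier x \<in> L2_functions lebesgue" by (simp add: L2_functions_def)
  then show "L2_sq lebesgue (fourier x) \<le> L2_sq lebesgue x"
    using * nn_integral_L2_sq[of "fourier x" lebesgue] by (simp add: ennreal_power)
qed

section \<open>Plancherel's theorem\<close>

lemma indicator_interval_L2:
  "(\<lambda>t. indicator {a..b::real} t :: complex) \<in> L2_functions lebesgue"
  "integrable lebesgue (\<lambda>t. indicator {a..b::real} t :: complex)"
proof -
  have "integrable lebesgue (\<lambda>t. indicator {a..b} t :: real)"
    by (rule integrable_real_indicator) (auto simp: emeasure_lborel_Icc_eq)
  then have "integrable lebesgue (\<lambda>t. complex_of_real (indicator {a..b} t))"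
    by (rule integrable_of_real)
  moreover have "(cmod (indicator {a..b} t))\<^sup>2 = indicator {a..b} t" for t
    by (simp add: indicator_def)
  ultimately show "integrable lebesgue (\<lambda>t. indicator {a..b::real} t :: complex)"
    and "(\<lambda>t. indicator {a..b::real} t :: complex) \<in> L2_functions lebesgue"
    using \<open>integrable lebesgue (\<lambda>t. indicator {a..b} t :: real)\<close>
    by (auto simp: L2_functions_def of_real_indicator)
qed

text \<open>Substituting \<open>b = a + s n * r\<close> fixes the density and leaves
  \<open>n\<close> only in the indicator, which is eventually constant off the endpoints. At an
  endpoint of a nondegenerate interval the limit would be 1/2.\<close>

lemma gaussian_average_indicator_tendsto:
  fixes s :: "nat \<Rightarrow> real" and a p q :: real
  assumes s: "\<And>n. s n > 0" and s0: "s \<longlonglongrightarrow> 0" and a: "a \<noteq> p" "a \<noteq> q"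
  shows "(\<lambda>n. LINT b|lebesgue. indicator {p..q} b * complex_of_real (normal_density a (s n) b))
    \<longlonglongrightarrow> indicator {p..q} a"
proof -
  have "(LINT b|lebesgue. indicator {p..q} b * complex_of_real (normal_density a (s n) b))
      = (LINT r|lborel. indicator {p..q} (a + s n * r) * complex_of_real (std_normal_density r))" for n
  proof -
    have nd: "normal_density a (s n) (a + s n * r) * s n = std_normal_density r" for r
      using s[of n] by (simp add: normal_density_def real_sqrt_mult power_mult_distrib)
    have [measurable]: "normal_density a (s n) \<in> borel_measurable borel" by simp
    have "(LINT b|lebesgue. indicator {p..q} b * complex_of_real (normal_density a (s n) b)) =
        (LINT b|lborel. indicator {p..q} b * complex_of_real (normal_density a (s n) b))"
      by (intro integral_completion borel_measurable_times borel_measurable_of_real) auto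
    also have "\<dots> = \<bar>s n\<bar> *\<^sub>R (LINT r|lborel. indicator {p..q} (a + s n * r) *
        complex_of_real (normal_density a (s n) (a + s n * r)))"
      using s[of n] by (intro lborel_integral_real_affine) auto
    also have "\<dots> = (LINT r|lborel. indicator {p..q} (a + s n * r) *
        complex_of_real (normal_density a (s n) (a + s n * r) * s n))"
      using s[of n] by (simp add: scaleR_conv_of_real mult_ac flip: integral_mult_right_zero)
    finally show ?thesis by (simp only: nd)
  qed
  moreover have "(\<lambda>n. LINT r|lborel. indicator {p..q} (a + s n * r) * complex_of_real (std_normal_density r))
      \<longlonglongrightarrow> (LINT r|lborel. indicator {p..q} a * complex_of_real (std_normal_density r))"
  proof (rule integral_dominated_convergence[where w=std_normal_density])
    show "integrable lborel std_normal_density" by simp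
    show "AE r in lborel. norm (indicator {p..q} (a + s n * r) * complex_of_real (std_normal_density r))
        \<le> std_normal_density r" for n
      by (auto simp: indicator_def norm_mult)
    show "AE r in lborel. (\<lambda>n. indicator {p..q} (a + s n * r) * complex_of_real (std_normal_density r))
        \<longlonglongrightarrow> indicator {p..q} a * complex_of_real (std_normal_density r)"
    proof (rule AE_I2)
      fix r
      have l: "(\<lambda>n. a + s n * r) \<longlonglongrightarrow> a"
        using tendsto_add[OF tendsto_const tendsto_mult[OF s0 tendsto_const], of a r] by simp
      have "\<forall>\<^sub>F n in sequentially. (indicator {p..q} (a + s n * r) :: complex) = indicator {p..q} a"
      proof (cases "a \<in> {p..q}")
        case True
        then have "p < a" "a < q" using a by auto
        then show ?thesis
          using eventually_conj[OF order_tendstoD(1)[OF l \<open>p < a\<close>] order_tendstoD(2)[OF l \<open>a < q\<close>]] True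
          by (auto simp: indicator_def elim!: eventually_mono)
      next
        case False
        then consider "a < p" | "q < a" by fastforce
        then show ?thesis
        proof cases
          case 1
          then show ?thesis
            using order_tendstoD(2)[OF l 1] False by (auto simp: indicator_def elim!: eventually_mono)
        next
          case 2
          then show ?thesis
            using order_tendstoD(1)[OF l 2] False by (auto simp: indicator_def elim!: eventually_mono)
        qed
      qed
      then have "(\<lambda>n. indicator {p..q} (a + s n * r) :: complex) \<longlonglongrightarrow> indicator {p..q} a"
        by (rule tendsto_eventually)
      then show "(\<lambda>n. indicator {p..q} (a + s n * r) * complex_of_real (std_normal_density r))
        \<longlonglongrightarrow> indicator {p..q} a * complex_of_real (std_normal_density r)"
        by (intro tendsto_mult tendsto_const)
    qed
    have "(indicator {p..q} :: real \<Rightarrow> complex) \<in> borel_measurable borel" by simp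
    then have "(\<lambda>r. indicator {p..q} (a + s n * r) :: complex) \<in> borel_measurable lborel" for n
      by (rule measurable_compose[rotated]) simp
    moreover have "(\<lambda>r. complex_of_real (std_normal_density r)) \<in> borel_measurable lborel"
      using measurable_compose[OF borel_measurable_normal_density borel_measurable_of_real] by simp
    ultimately show "(\<lambda>r. indicator {p..q} (a + s n * r) * complex_of_real (std_normal_density r)) \<in> borel_measurable lborel"
      and "(\<lambda>r. indicator {p..q} a * complex_of_real (std_normal_density r)) \<in> borel_measurable lborel" for n
      by (auto intro!: borel_measurable_times)
  qed
  moreover have "(LINT r|lborel. indicator {p..q} a * complex_of_real (std_normal_density r)) = indicator {p..q} a"
    by (simp only: integral_mult_right_zero integral_complex_of_real) simp
  ultimately show ?thesis by simp
qed

text \<open>Both sides of the regularised formula converge by dominated convergence. On the left the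
  dominating function is the product of two transforms, integrable by the contraction; on the right
  the averages of the indicator have modulus at most 1 and converge off two points, so
  \<open>cmod (x a)\<close> dominates.\<close>

lemma parseval_indicator:
  fixes p q :: real
  assumes x: "x \<in> L2_functions lebesgue" and x1: "integrable lebesgue x"
  shows "(LINT t|lebesgue. fourier x t * cnj (fourier (indicator {p..q}) t))
    = (LINT t|lebesgue. x t * indicator {p..q} t)"
proof -
  let ?z = "indicator {p..q} :: real \<Rightarrow> complex"
  note z = indicator_interval_L2[of p q]
  have [measurable]: "x \<in> borel_measurable lebesgue" "?z \<in> borel_measurable lebesgue"
    using x z by (auto simp: L2_measurable)
  define s where "s n = 1 / real (Suc n)" for n
  have s: "s n > 0" for n by (simp add: s_def)
  have s0: "s \<longlonglongrightarrow> 0" unfolding s_def using LIMSEQ_Suc[OF lim_const_over_n[of 1]] by simp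
  let ?\<gamma> = "\<lambda>n t. complex_of_real (exp (- (s n * t)\<^sup>2 / 2))"
  have F: "fourier x \<in> L2_functions lebesgue" "(\<lambda>t. cnj (fourier ?z t)) \<in> L2_functions lebesgue"
    using fourier_L2_contraction(1)[OF x x1] L2_cnj(1)[OF fourier_L2_contraction(1)[OF z]] by auto
  have "(\<lambda>n. LINT t|lebesgue. fourier x t * (cnj (fourier ?z t) * ?\<gamma> n t))
      \<longlonglongrightarrow> (LINT t|lebesgue. fourier x t * cnj (fourier ?z t))"
  proof (rule integral_dominated_convergence[where w="\<lambda>t. cmod (fourier x t * cnj (fourier ?z t))"])
    show "integrable lebesgue (\<lambda>t. cmod (fourier x t * cnj (fourier ?z t)))"
      using L2_mult_integrable[OF F] by (rule integrable_norm)
    show "AE t in lebesgue. (\<lambda>n. fourier x t * (cnj (fourier ?z t) * ?\<gamma> n t)) \<longlonglongrightarrow> fourier x t * cnj (fourier ?z t)"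
    proof (rule AE_I2)
      fix t
      have "(\<lambda>n. fourier x t * (cnj (fourier ?z t) * ?\<gamma> n t)) \<longlonglongrightarrow>
          fourier x t * (cnj (fourier ?z t) * complex_of_real (exp (- (0 * t)\<^sup>2 / 2)))"
        by (intro tendsto_intros s0) simp
      then show "(\<lambda>n. fourier x t * (cnj (fourier ?z t) * ?\<gamma> n t)) \<longlonglongrightarrow> fourier x t * cnj (fourier ?z t)"
        by simp
    qed
    show "AE t in lebesgue. norm (fourier x t * (cnj (fourier ?z t) * ?\<gamma> n t))
        \<le> cmod (fourier x t * cnj (fourier ?z t))" for n
      unfolding norm_mult by (intro AE_I2 mult_left_mono mult_left_le) auto
  qed measurable
  moreover have "(\<lambda>n. LINT t|lebesgue. fourier x t * (cnj (fourier ?z t) * ?\<gamma> n t))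
      \<longlonglongrightarrow> (LINT a|lebesgue. x a * cnj (?z a))"
    unfolding regularised_parseval[OF x1 z(2) s]
  proof (rule integral_dominated_convergence[where w="\<lambda>a. cmod (x a)"])
    show "integrable lebesgue (\<lambda>a. cmod (x a))" using x1 by (rule integrable_norm)
    have "AE a in lebesgue. a \<noteq> p \<and> a \<noteq> q"
      using AE_completion[OF AE_lborel_singleton[of p]] AE_completion[OF AE_lborel_singleton[of q]]
      by eventually_elim simp
    then show "AE a in lebesgue. (\<lambda>n. x a * cnj (LINT b|lebesgue. ?z b * complex_of_real (normal_density a (s n) b)))
        \<longlonglongrightarrow> x a * cnj (?z a)"
    proof eventually_elim
      case (elim a)
      then show ?case
        using gaussian_average_indicator_tendsto[OF s s0, of a p q]
        by (intro tendsto_mult tendsto_cnj tendsto_const) auto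
    qed
    show "AE a in lebesgue. norm (x a * cnj (LINT b|lebesgue. ?z b * complex_of_real (normal_density a (s n) b)))
        \<le> cmod (x a)" for n
    proof (rule AE_I2)
      fix a
      have "ennreal (cmod (LINT b|lebesgue. ?z b * complex_of_real (normal_density a (s n) b)))
          \<le> (\<integral>\<^sup>+b. ennreal (cmod (?z b * complex_of_real (normal_density a (s n) b))) \<partial>lebesgue)"
        by (rule norm_integral_le_nn_integral)
      also have "\<dots> \<le> (\<integral>\<^sup>+b. ennreal (normal_density a (s n) b) \<partial>lebesgue)"
        by (intro nn_integral_mono ennreal_leI) (auto simp: indicator_def)
      also have "\<dots> = 1" by (rule nn_integral_normal_density[OF s])
      finally show "norm (x a * cnj (LINT b|lebesgue. ?z b * complex_of_real (normal_density a (s n) b))) \<le> cmod (x a)"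
        unfolding norm_mult complex_mod_cnj by (intro mult_left_le) auto
    qed
  qed measurable
  ultimately have "(LINT t|lebesgue. fourier x t * cnj (fourier ?z t)) = (LINT a|lebesgue. x a * cnj (?z a))"
    by (rule LIMSEQ_unique)
  moreover have "cnj (?z a) = ?z a" for a by (simp add: indicator_def)
  ultimately show ?thesis by simp
qed

text \<open>Lebesgue differentiation: almost everywhere \<open>g\<close> is the limit of its
  averages over intervals to the right of the point, all of which vanish. The differentiation
  theorem concerns the gauge integral, hence the passage to \<open>has_integral\<close>.\<close>

lemma AE_zero_if_integral_intervals_zero:
  fixes g :: "real \<Rightarrow> complex"
  assumes g: "g \<in> L2_functions lebesgue"
    and zero: "\<And>a b. (LINT t|lebesgue. g t * indicator {a..b} t) = 0"
  shows "AE t in lebesgue. g t = 0"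
proof -
  have int: "(g has_integral 0) (cbox a b)" for a b
  proof -
    have eq: "(\<lambda>t. g t * indicator {a..b} t) = (\<lambda>t. indicat_real {a..b} t *\<^sub>R g t)"
      by (auto simp: indicator_def)
    have "set_integrable lebesgue {a..b} g"
      using L2_mult_integrable[OF g indicator_interval_L2(1)[of a b]]
      unfolding set_integrable_def eq .
    moreover have "set_lebesgue_integral lebesgue {a..b} g = 0"
      using zero[of a b] unfolding set_lebesgue_integral_def eq .
    ultimately show ?thesis
      by (simp add: has_integral_iff set_lebesgue_integral_eq_integral)
  qed
  obtain N where N: "negligible N" and
      lim: "\<And>x e. x \<notin> N \<Longrightarrow> 0 < e \<Longrightarrow> \<exists>d>0. \<forall>h. 0 < h \<and> h < d \<longrightarrow>
          norm (integral (cbox x (x + h *\<^sub>R One)) g /\<^sub>R h ^ DIM(real) - g x) < e"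
    using integrable_ccontinuous_explicit[of g] int by (metis has_integral_integrable)
  have "g x = 0" if x: "x \<notin> N" for x
  proof (rule ccontr)
    assume "g x \<noteq> 0"
    then obtain d where "d > 0" and d: "\<And>h. 0 < h \<Longrightarrow> h < d \<Longrightarrow>
        norm (integral (cbox x (x + h *\<^sub>R One)) g /\<^sub>R h ^ DIM(real) - g x) < norm (g x)"
      using lim[OF x, of "norm (g x)"] by auto
    then show False using d[of "d/2"] integral_unique[OF int] by simp
  qed
  moreover have "N \<in> null_sets lebesgue" using N by (simp add: negligible_iff_null_sets)
  ultimately show ?thesis by (auto intro: AE_I')
qed

subsection \<open>The Fourier transform as a relation between square-integrable functions\<close>

text \<open>A square-integrable function is integrable over a bounded interval, so the Fourier
  integral is available for truncations.\<close>

definition truncation :: "(real \<Rightarrow> complex) \<Rightarrow> nat \<Rightarrow> real \<Rightarrow> complex" where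
  "truncation x n t = x t * indicator {- real n..real n} t"

text \<open>A function \<open>y\<close> is a Fourier--Plancherel transform of \<open>x\<close>: it is the mean-square limit of the
  Fourier integrals of the truncations of \<open>x\<close>, and so is determined only almost everywhere.\<close>

definition plancherel_pair :: "(real \<Rightarrow> complex) \<Rightarrow> (real \<Rightarrow> complex) \<Rightarrow> bool" where
  "plancherel_pair x y \<longleftrightarrow>
     x \<in> L2_functions lebesgue \<and> L2_tendsto lebesgue (\<lambda>n. fourier (truncation x n)) y"

lemma truncation_integrable:
  assumes "x \<in> L2_functions lebesgue"
  shows "integrable lebesgue (truncation x n)"
  using L2_mult_integrable[OF assms indicator_interval_L2(1)] by (simp add: truncation_def[abs_def])

lemma truncation_L2:
  assumes x: "x \<in> L2_functions lebesgue"
  shows "truncation x n \<in> L2_functions lebesgue"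
proof -
  have [measurable]: "x \<in> borel_measurable lebesgue" "(indicator {- real n..real n} :: real \<Rightarrow> complex) \<in> borel_measurable lebesgue"
    using x indicator_interval_L2(1) by (auto simp: L2_measurable)
  have m: "truncation x n \<in> borel_measurable lebesgue" unfolding truncation_def[abs_def] by measurable
  have "integrable lebesgue (\<lambda>t. (cmod (truncation x n t))\<^sup>2)"
    by (rule Bochner_Integration.integrable_bound[OF L2_integrable_sq[OF x]])
      (use m in \<open>auto simp: truncation_def indicator_def\<close>)
  then show ?thesis using m by (simp add: L2_functions_def)
qed

lemma truncation_tendsto:
  assumes x: "x \<in> L2_functions lebesgue"
  shows "L2_tendsto lebesgue (truncation x) x"
proof -
  have [measurable]: "x \<in> borel_measurable lebesgue" "truncation x n \<in> borel_measurable lebesgue" for n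
    using x truncation_L2 by (auto simp: L2_measurable)
  have "(\<lambda>n. L2_sq lebesgue (\<lambda>t. truncation x n t - x t)) \<longlonglongrightarrow> (LINT t|(lebesgue::real measure). 0)"
    unfolding L2_sq_def
  proof (rule integral_dominated_convergence[where w="\<lambda>t. (cmod (x t))\<^sup>2"])
    show "integrable lebesgue (\<lambda>t. (cmod (x t))\<^sup>2)" by (rule L2_integrable_sq[OF x])
    show "AE t in lebesgue. norm ((cmod (truncation x n t - x t))\<^sup>2) \<le> (cmod (x t))\<^sup>2" for n
      by (auto simp: truncation_def indicator_def)
    show "AE t in lebesgue. (\<lambda>n. (cmod (truncation x n t - x t))\<^sup>2) \<longlonglongrightarrow> 0"
    proof (rule AE_I2)
      fix t
      have "(cmod (truncation x n t - x t))\<^sup>2 = 0" if "n \<ge> nat \<lceil>\<bar>t\<bar>\<rceil>" for n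
      proof -
        have "\<bar>t\<bar> \<le> real n" using that by linarith
        then show ?thesis by (auto simp: truncation_def indicator_def)
      qed
      then show "(\<lambda>n. (cmod (truncation x n t - x t))\<^sup>2) \<longlonglongrightarrow> 0"
        by (intro tendsto_eventually eventually_sequentiallyI)
    qed
  qed measurable
  then show ?thesis using x truncation_L2[OF x] by (simp add: L2_tendsto_def)
qed

lemma fourier_tendsto:
  assumes f: "L2_tendsto lebesgue f x"
    and f1: "\<And>n. integrable lebesgue (f n)" and x1: "integrable lebesgue x"
  shows "L2_tendsto lebesgue (\<lambda>n. fourier (f n)) (fourier x)"
proof -
  have L: "f n \<in> L2_functions lebesgue" "x \<in> L2_functions lebesgue" for n
    using f by (auto simp: L2_tendsto_def)
  have le: "L2_sq lebesgue (\<lambda>t. fourier (f n) t - fourier x t) \<le> L2_sq lebesgue (\<lambda>t. f n t - x t)" for n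
    using fourier_L2_contraction(2)[OF L2_diff(1)[OF L], of n] f1 x1 by (simp add: fourier_diff)
  have "(\<lambda>n. L2_sq lebesgue (\<lambda>t. fourier (f n) t - fourier x t)) \<longlonglongrightarrow> 0"
    by (rule tendsto_sandwich[where f="\<lambda>_. 0"]) (use f le in \<open>auto simp: L2_tendsto_def\<close>)
  then show ?thesis using fourier_L2_contraction(1) L f1 x1 by (simp add: L2_tendsto_def)
qed

section \<open>Existence, uniqueness and linearity of the transform\<close>

lemma plancherel_pair_fourier:
  "x \<in> L2_functions lebesgue \<Longrightarrow> integrable lebesgue x \<Longrightarrow> plancherel_pair x (fourier x)"
  by (simp add: plancherel_pair_def fourier_tendsto truncation_tendsto truncation_integrable)

lemma plancherel_pair_L2:
  assumes "plancherel_pair x y"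
  shows "x \<in> L2_functions lebesgue" "y \<in> L2_functions lebesgue"
  using assms by (auto simp: plancherel_pair_def L2_tendsto_def)

text \<open>The contraction makes the Fourier integrals of the truncations a Cauchy sequence, and
  completeness supplies the limit.\<close>

lemma plancherel_pair_exists:
  assumes x: "x \<in> L2_functions lebesgue"
  obtains y where "plancherel_pair x y"
proof -
  have F: "fourier (truncation x n) \<in> L2_functions lebesgue" for n
    by (rule fourier_L2_contraction(1)[OF truncation_L2[OF x] truncation_integrable[OF x]])
  have d: "(\<lambda>t. truncation x n t - x t) \<in> L2_functions lebesgue" for n
    by (rule L2_diff(1)[OF truncation_L2[OF x] x])
  have "\<exists>N. \<forall>m\<ge>N. \<forall>n\<ge>N. L2_sq lebesgue (\<lambda>t. fourier (truncation x m) t - fourier (truncation x n) t) < e" if "e > 0" for e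
  proof -
    have "(\<lambda>n. L2_sq lebesgue (\<lambda>t. truncation x n t - x t)) \<longlonglongrightarrow> 0"
      using truncation_tendsto[OF x] by (simp add: L2_tendsto_def)
    \<comment> \<open>The quarter compensates for the factor 2 on each of the two terms in
      \<open>L2_diff\<close>.\<close>
    then obtain N where N: "\<And>n. n \<ge> N \<Longrightarrow> L2_sq lebesgue (\<lambda>t. truncation x n t - x t) < e / 4"
      using order_tendstoD(2)[of _ 0 sequentially "e/4"] \<open>e > 0\<close> by (auto simp: eventually_sequentially)
    have "L2_sq lebesgue (\<lambda>t. fourier (truncation x m) t - fourier (truncation x n) t) < e" if "m \<ge> N" "n \<ge> N" for m n
    proof -
      have "L2_sq lebesgue (\<lambda>t. fourier (truncation x m) t - fourier (truncation x n) t)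
          = L2_sq lebesgue (fourier (\<lambda>t. truncation x m t - truncation x n t))"
        by (simp add: fourier_diff truncation_integrable x)
      also have "\<dots> \<le> L2_sq lebesgue (\<lambda>t. truncation x m t - truncation x n t)"
        by (intro fourier_L2_contraction(2) L2_diff(1) truncation_L2 x Bochner_Integration.integrable_diff truncation_integrable)
      also have "\<dots> = L2_sq lebesgue (\<lambda>t. (truncation x m t - x t) - (truncation x n t - x t))" by simp
      also have "\<dots> \<le> 2 * L2_sq lebesgue (\<lambda>t. truncation x m t - x t) + 2 * L2_sq lebesgue (\<lambda>t. truncation x n t - x t)"
        by (rule L2_diff(2)[OF d d])
      also have "\<dots> < e" using N[OF that(1)] N[OF that(2)] by simp
      finally show ?thesis .
    qed
    then show ?thesis by blast
  qed
  then obtain y where "L2_tendsto lebesgue (\<lambda>n. fourier (truncation x n)) y"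
    by (rule L2_complete[of "\<lambda>n. fourier (truncation x n)", OF F])
  then show ?thesis using that x by (simp add: plancherel_pair_def)
qed

lemma plancherel_pair_unique:
  "plancherel_pair x y \<Longrightarrow> plancherel_pair x y' \<Longrightarrow> AE t in lebesgue. y t = y' t"
  by (auto simp: plancherel_pair_def intro: L2_tendsto_unique)

text \<open>This lets the relation descend to classes. Changing \<open>x\<close> on a null set
  leaves the Fourier integrals of its truncations unchanged at every point.\<close>

lemma plancherel_pair_cong_AE:
  assumes "plancherel_pair x y" "x' \<in> borel_measurable lebesgue" "y' \<in> borel_measurable lebesgue"
    and "AE t in lebesgue. x t = x' t" "AE t in lebesgue. y t = y' t"
  shows "plancherel_pair x' y'"
proof -
  have [measurable]: "x \<in> borel_measurable lebesgue" "x' \<in> borel_measurable lebesgue"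
    using plancherel_pair_L2(1)[OF assms(1)] assms(2) by (auto simp: L2_measurable)
  have [measurable]: "(indicator {- real n..real n} :: real \<Rightarrow> complex) \<in> borel_measurable lebesgue" for n
    using indicator_interval_L2(1) by (auto simp: L2_measurable)
  have "fourier (truncation x n) t = fourier (truncation x' n) t" for n t
    unfolding fourier_def truncation_def
  proof (rule arg_cong[where f="\<lambda>u. _ * u"], rule integral_cong_AE)
    show "AE \<xi> in lebesgue. exp (\<i> * complex_of_real (t * \<xi>)) * (x \<xi> * indicator {- real n..real n} \<xi>)
        = exp (\<i> * complex_of_real (t * \<xi>)) * (x' \<xi> * indicator {- real n..real n} \<xi>)"
      using assms(4) by eventually_elim simp
  qed measurable
  then have F: "(\<lambda>n. fourier (truncation x n)) = (\<lambda>n. fourier (truncation x' n))" by auto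
  have "L2_tendsto lebesgue (\<lambda>n. fourier (truncation x n)) y'"
    by (rule L2_tendsto_cong_AE[OF _ assms(3,5)]) (use assms(1) in \<open>simp add: plancherel_pair_def\<close>)
  moreover have "x' \<in> L2_functions lebesgue"
    by (rule L2_cong_AE(1)[OF plancherel_pair_L2(1)[OF assms(1)] assms(2,4)])
  ultimately show ?thesis unfolding plancherel_pair_def F by blast
qed

lemma plancherel_pair_add:
  assumes "plancherel_pair x y" "plancherel_pair x' y'"
  shows "plancherel_pair (\<lambda>t. x t + x' t) (\<lambda>t. y t + y' t)"
proof -
  have "truncation (\<lambda>t. x t + x' t) n = (\<lambda>t. truncation x n t + truncation x' n t)" for n
    by (simp add: truncation_def fun_eq_iff distrib_right)
  then have "fourier (truncation (\<lambda>t. x t + x' t) n) t = fourier (truncation x n) t + fourier (truncation x' n) t" for n t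
    using assms by (simp add: fourier_add truncation_integrable plancherel_pair_def)
  then have "(\<lambda>n. fourier (truncation (\<lambda>t. x t + x' t) n)) = (\<lambda>n t. fourier (truncation x n) t + fourier (truncation x' n) t)"
    by auto
  then show ?thesis using assms by (auto simp: plancherel_pair_def intro: L2_add L2_tendsto_add)
qed

lemma plancherel_pair_cmult:
  assumes "plancherel_pair x y"
  shows "plancherel_pair (\<lambda>t. c * x t) (\<lambda>t. c * y t)"
proof -
  have "truncation (\<lambda>t. c * x t) n = (\<lambda>t. c * truncation x n t)" for n
    by (simp add: truncation_def fun_eq_iff)
  then have "fourier (truncation (\<lambda>t. c * x t) n) t = c * fourier (truncation x n) t" for n t
    by (simp add: fourier_cmult)
  then have "(\<lambda>n. fourier (truncation (\<lambda>t. c * x t) n)) = (\<lambda>n t. c * fourier (truncation x n) t)"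
    by auto
  then show ?thesis using assms by (auto simp: plancherel_pair_def intro: L2_cmult L2_tendsto_cmult)
qed

text \<open>The limit of \<open>fourier_pairing\<close> along truncations. Inversion, isometry and
  the formula for the adjoint all rest on this symmetry.\<close>

lemma plancherel_pair_pairing:
  assumes "plancherel_pair x y" "plancherel_pair x' y'"
  shows "(LINT t|lebesgue. y t * x' t) = (LINT t|lebesgue. x t * y' t)"
proof (rule LIMSEQ_unique)
  have L: "x \<in> L2_functions lebesgue" "x' \<in> L2_functions lebesgue"
    using assms by (auto simp: plancherel_pair_def)
  show "(\<lambda>n. LINT t|lebesgue. fourier (truncation x n) t * truncation x' n t) \<longlonglongrightarrow> (LINT t|lebesgue. y t * x' t)"
    using assms L by (intro L2_tendsto_mult truncation_tendsto) (auto simp: plancherel_pair_def)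
  show "(\<lambda>n. LINT t|lebesgue. fourier (truncation x n) t * truncation x' n t) \<longlonglongrightarrow> (LINT t|lebesgue. x t * y' t)"
    unfolding fourier_pairing[OF truncation_integrable[OF L(1)] truncation_integrable[OF L(2)]]
    using assms L by (intro L2_tendsto_mult truncation_tendsto) (auto simp: plancherel_pair_def)
qed

text \<open>Fourier inversion: conjugation turns the transform into its own inverse. By the pairing
  identity, the integrals of both sides over an interval are Parseval's formula for its
  indicator function.\<close>

lemma plancherel_pair_inverse:
  assumes xy: "plancherel_pair x y"
  shows "plancherel_pair (\<lambda>t. cnj (y t)) (\<lambda>t. cnj (x t))"
proof -
  note L = plancherel_pair_L2[OF xy]
  obtain v where v: "plancherel_pair (\<lambda>t. cnj (y t)) v"
    using plancherel_pair_exists[OF L2_cnj(1)[OF L(2)]] by blast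
  note Lv = plancherel_pair_L2(2)[OF v]
  have "(LINT t|lebesgue. (v t - cnj (x t)) * indicator {p..q} t) = 0" for p q :: real
  proof -
    let ?z = "indicator {p..q} :: real \<Rightarrow> complex"
    note z = indicator_interval_L2[of p q]
    have cz: "cnj (?z t) = ?z t" for t by (simp add: indicator_def)
    have "(\<lambda>n. LINT t|lebesgue. fourier (truncation x n) t * cnj (fourier ?z t))
        \<longlonglongrightarrow> (LINT t|lebesgue. y t * cnj (fourier ?z t))"
      using xy L2_cnj(1)[OF fourier_L2_contraction(1)[OF z]]
      by (intro L2_tendsto_mult L2_tendsto_const) (auto simp: plancherel_pair_def)
    moreover have "(\<lambda>n. LINT t|lebesgue. fourier (truncation x n) t * cnj (fourier ?z t))
        \<longlonglongrightarrow> (LINT t|lebesgue. x t * ?z t)"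
      unfolding parseval_indicator[OF truncation_L2[OF L(1)] truncation_integrable[OF L(1)]]
      using L2_tendsto_mult[OF truncation_tendsto[OF L(1)] L2_tendsto_const[OF z(1)]] .
    ultimately have "(LINT t|lebesgue. y t * cnj (fourier ?z t)) = (LINT t|lebesgue. x t * ?z t)"
      by (rule LIMSEQ_unique)
    moreover have "(LINT t|lebesgue. fourier ?z t * cnj (y t)) = (LINT t|lebesgue. ?z t * v t)"
      by (rule plancherel_pair_pairing[OF plancherel_pair_fourier[OF z] v])
    moreover have "cnj (LINT t|lebesgue. y t * cnj (fourier ?z t)) = (LINT t|lebesgue. fourier ?z t * cnj (y t))"
      by (subst Bochner_Integration.integral_cnj[symmetric]) (simp add: mult.commute)
    moreover have "cnj (LINT t|lebesgue. x t * ?z t) = (LINT t|lebesgue. cnj (x t) * ?z t)"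
      by (subst Bochner_Integration.integral_cnj[symmetric]) (simp add: cz)
    ultimately have "(LINT t|lebesgue. v t * ?z t) = (LINT t|lebesgue. cnj (x t) * ?z t)"
      by (simp add: mult.commute)
    then show ?thesis
      using L2_mult_integrable[OF Lv z(1)] L2_mult_integrable[OF L2_cnj(1)[OF L(1)] z(1)]
      by (simp add: left_diff_distrib)
  qed
  then have "AE t in lebesgue. v t - cnj (x t) = 0"
    by (intro AE_zero_if_integral_intervals_zero L2_diff(1) Lv L2_cnj(1) L(1))
  then show ?thesis
    using L2_measurable[OF L(1)] L2_measurable[OF L(2)]
    by (intro plancherel_pair_cong_AE[OF v]) (auto intro!: borel_measurable_cnj)
qed

text \<open>By inversion \<open>cnj y'\<close> has the transform \<open>cnj x'\<close>, which makes
  isometry an instance of the pairing identity.\<close>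

lemma plancherel_pair_inner:
  assumes "plancherel_pair x y" "plancherel_pair x' y'"
  shows "(LINT t|lebesgue. y t * cnj (y' t)) = (LINT t|lebesgue. x t * cnj (x' t))"
  by (rule plancherel_pair_pairing[OF assms(1) plancherel_pair_inverse[OF assms(2)]])

lemma plancherel_pair_sq:
  assumes "plancherel_pair x y"
  shows "L2_sq lebesgue y = L2_sq lebesgue x"
proof -
  have "complex_of_real (L2_sq lebesgue y) = complex_of_real (L2_sq lebesgue x)"
    by (simp only: complex_of_real_L2_sq plancherel_pair_inner[OF assms assms])
  then show ?thesis by simp
qed

subsection \<open>Reflection and conjugation\<close>

lemma L2_reflect:
  fixes x :: "real \<Rightarrow> complex"
  assumes "x \<in> L2_functions lebesgue"
  shows "(\<lambda>t. x (- t)) \<in> L2_functions lebesgue"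
    and "L2_sq lebesgue (\<lambda>t. x (- t)) = L2_sq lebesgue x"
proof -
  have "(\<lambda>t. x (- t)) \<in> borel_measurable lebesgue"
    using borel_measurable_affine[OF L2_measurable[OF assms], of "-1" 0] by simp
  moreover have "integrable lebesgue (\<lambda>t. (cmod (x (- t)))\<^sup>2)"
    using lebesgue_integrable_real_affine[OF L2_integrable_sq[OF assms], of "-1" 0] by simp
  ultimately show "(\<lambda>t. x (- t)) \<in> L2_functions lebesgue" by (simp add: L2_functions_def)
  show "L2_sq lebesgue (\<lambda>t. x (- t)) = L2_sq lebesgue x"
    using lebesgue_integral_real_affine[of "-1" "\<lambda>t. (cmod (x t))\<^sup>2" 0] by (simp add: L2_sq_def)
qed

lemma plancherel_pair_reflect:
  assumes "plancherel_pair x y"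
  shows "plancherel_pair (\<lambda>t. x (- t)) (\<lambda>t. y (- t))"
proof -
  \<comment> \<open>The truncation interval is symmetric about 0, so truncation commutes with
    reflection.\<close>
  have "truncation (\<lambda>t. x (- t)) n = (\<lambda>t. truncation x n (- t))" for n
    by (auto simp: truncation_def fun_eq_iff indicator_def)
  then have F: "fourier (truncation (\<lambda>t. x (- t)) n) = (\<lambda>t. fourier (truncation x n) (- t))" for n
    by (intro ext) (simp add: fourier_reflect)
  have "L2_tendsto lebesgue (\<lambda>n t. fourier (truncation x n) (- t)) (\<lambda>t. y (- t))"
    using assms L2_reflect(1) L2_reflect(2)[OF L2_diff(1)]
    by (auto simp: plancherel_pair_def L2_tendsto_def)
  then show ?thesis
    using assms by (simp add: plancherel_pair_def F L2_reflect)
qed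

text \<open>Conjugating the kernel changes the sign of t. Through this reflection the pairing
  without conjugation yields the adjoint for the inner product.\<close>

lemma plancherel_pair_cnj:
  assumes "plancherel_pair x y"
  shows "plancherel_pair (\<lambda>t. cnj (x t)) (\<lambda>t. cnj (y (- t)))"
proof -
  have xy: "plancherel_pair (\<lambda>t. x (- t)) (\<lambda>t. y (- t))"
    by (rule plancherel_pair_reflect[OF assms])
  \<comment> \<open>Passing through the reflected function makes the transforms literal conjugates
    of the sequence in \<open>xy\<close>, to which \<open>L2_tendsto_cnj\<close> applies.\<close>
  have "truncation (\<lambda>t. cnj (x t)) n = (\<lambda>t. cnj (truncation (\<lambda>t. x (- t)) n (- t)))" for n
    by (auto simp: truncation_def fun_eq_iff indicator_def)
  then have "fourier (truncation (\<lambda>t. cnj (x t)) n) = (\<lambda>t. cnj (fourier (truncation (\<lambda>t. x (- t)) n) t))" for n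
    by (intro ext) (simp add: fourier_cnj fourier_reflect)
  then show ?thesis
    using xy assms L2_tendsto_cnj by (auto simp: plancherel_pair_def L2_cnj)
qed

section \<open>The Hilbert space of classes\<close>

lemma L2_class_in_space: "x \<in> L2_functions M \<Longrightarrow> L2_class M x \<in> L2_space M"
  by (auto simp: L2_class_def L2_space_def intro: quotientI)

lemma L2_class_eq_iff:
  assumes "x \<in> L2_functions M" "y \<in> L2_functions M"
  shows "L2_class M x = L2_class M y \<longleftrightarrow> (AE t in M. x t = y t)"
  unfolding L2_class_def
  using eq_equiv_class_iff[OF equiv_L2_rel assms] assms by (simp add: L2_rel_def)

lemma L2_class_eqI:
  "x \<in> L2_functions M \<Longrightarrow> y \<in> L2_functions M \<Longrightarrow> AE t in M. x t = y t \<Longrightarrow> L2_class M x = L2_class M y"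
  by (simp add: L2_class_eq_iff)

lemma L2_space_cases:
  assumes "u \<in> L2_space M"
  obtains x where "x \<in> L2_functions M" "u = L2_class M x"
  using assms by (auto simp: L2_space_def L2_class_def elim: quotientE)

lemma L2_add_class:
  assumes "x \<in> L2_functions M" "y \<in> L2_functions M"
  shows "L2_add M (L2_class M x) (L2_class M y) = L2_class M (\<lambda>t. x t + y t)"
  unfolding L2_add_def
  using L2_rep_class(2)[OF assms(1)] L2_rep_class(2)[OF assms(2)]
  by (intro L2_class_eqI L2_add L2_rep_class assms) auto

lemma L2_scale_class:
  assumes "x \<in> L2_functions M"
  shows "L2_scale M c (L2_class M x) = L2_class M (\<lambda>t. c * x t)"
  unfolding L2_scale_def
  using L2_rep_class(2)[OF assms]
  by (intro L2_class_eqI L2_cmult L2_rep_class assms) auto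

lemma L2_norm_class:
  assumes "x \<in> L2_functions M"
  shows "L2_norm M (L2_class M x) = sqrt (L2_sq M x)"
  using complex_of_real_L2_sq[of M x] by (simp add: L2_norm_def L2_inner_class[OF assms assms] flip: complex_of_real_L2_sq)

lemma L2_inner_nondegenerate:
  assumes v: "v \<in> L2_space M" and w: "w \<in> L2_space M"
    and eq: "\<And>u. u \<in> L2_space M \<Longrightarrow> L2_inner M u v = L2_inner M u w"
  shows "v = w"
proof -
  obtain x where x: "x \<in> L2_functions M" "v = L2_class M x" using v by (rule L2_space_cases)
  obtain y where y: "y \<in> L2_functions M" "w = L2_class M y" using w by (rule L2_space_cases)
  \<comment> \<open>Testing against the difference itself turns the equality of inner products into
    the vanishing of its square norm.\<close>
  let ?z = "\<lambda>t. x t - y t"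
  have z: "?z \<in> L2_functions M" by (rule L2_diff(1)[OF x(1) y(1)])
  have "(LINT t|M. ?z t * cnj (x t)) = (LINT t|M. ?z t * cnj (y t))"
    using eq[OF L2_class_in_space[OF z]] x y z by (simp add: L2_inner_class)
  then have "(LINT t|M. ?z t * cnj (x t) - ?z t * cnj (y t)) = 0"
    using L2_mult_integrable[OF z L2_cnj(1)[OF x(1)]] L2_mult_integrable[OF z L2_cnj(1)[OF y(1)]]
    by simp
  then have "complex_of_real (L2_sq M ?z) = 0"
    unfolding complex_of_real_L2_sq by (simp only: right_diff_distrib[symmetric] complex_cnj_diff)
  then have "AE t in M. ?z t = 0"
    using z by (intro L2_sq_zero_imp_AE) auto
  then show ?thesis using x y by (simp add: L2_class_eq_iff)
qed

text \<open>Nondegeneracy of the inner product determines the adjoint on the carrier, and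
  extensionality determines it elsewhere; together they meet the uniqueness demand of the definite
  description.\<close>

lemma L2_adjoint_eqI:
  assumes S: "S \<in> L2_space M \<rightarrow>\<^sub>E L2_space M"
    and adj: "\<And>u v. u \<in> L2_space M \<Longrightarrow> v \<in> L2_space M \<Longrightarrow> L2_inner M (T u) v = L2_inner M u (S v)"
  shows "L2_adjoint M T = S"
  unfolding L2_adjoint_def
proof (rule the_equality)
  fix S' assume S': "S' \<in> L2_space M \<rightarrow>\<^sub>E L2_space M \<and>
      (\<forall>u\<in>L2_space M. \<forall>v\<in>L2_space M. L2_inner M (T u) v = L2_inner M u (S' v))"
  show "S' = S"
  proof (rule PiE_ext)
    fix v assume v: "v \<in> L2_space M"
    show "S' v = S v"
      using S S' adj v by (intro L2_inner_nondegenerate[of _ M]) (auto dest: PiE_mem)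
  qed (use S S' in auto)
qed (use assms in auto)

section \<open>The Fourier--Plancherel operator\<close>

text \<open>Isometry brought down to representatives, for an arbitrary unitary operator: it serves
  to compare any candidate for \<open>fourier_plancherel\<close> with the constructed one.\<close>

lemma L2_unitary_sq_diff:
  assumes T: "L2_unitary M T" and L: "x \<in> L2_functions M" "x' \<in> L2_functions M" "y \<in> L2_functions M" "y' \<in> L2_functions M"
    and Tx: "T (L2_class M x) = L2_class M y" "T (L2_class M x') = L2_class M y'"
  shows "L2_sq M (\<lambda>t. y t - y' t) = L2_sq M (\<lambda>t. x t - x' t)"
proof -
  have lin: "L2_linear M T" using T by (simp add: L2_unitary_def)
  let ?u = "L2_class M (\<lambda>t. x t + (-1) * x' t)"
  have xx: "(\<lambda>t. x t + (-1) * x' t) \<in> L2_functions M" "(\<lambda>t. y t + (-1) * y' t) \<in> L2_functions M"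
    by (intro L2_add(1) L2_cmult(1) L)+
  have "?u = L2_add M (L2_class M x) (L2_scale M (-1) (L2_class M x'))"
    by (subst L2_scale_class[OF L(2)], subst L2_add_class[OF L(1) L2_cmult(1)[OF L(2)]], rule refl)
  moreover have "L2_scale M (-1) (L2_class M x') \<in> L2_space M"
    by (subst L2_scale_class[OF L(2)], intro L2_class_in_space L2_cmult(1) L)
  ultimately have "T ?u = L2_add M (T (L2_class M x)) (L2_scale M (-1) (T (L2_class M x')))"
    using lin L2_class_in_space[OF L(1)] L2_class_in_space[OF L(2)] by (simp add: L2_linear_def)
  also have "\<dots> = L2_class M (\<lambda>t. y t + (-1) * y' t)"
    unfolding Tx by (subst L2_scale_class[OF L(4)], subst L2_add_class[OF L(3) L2_cmult(1)[OF L(4)]], rule refl)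
  finally have Tu: "T ?u = L2_class M (\<lambda>t. y t + (-1) * y' t)" .
  have "L2_inner M (T ?u) (T ?u) = L2_inner M ?u ?u"
    using T L2_class_in_space[OF xx(1)] unfolding L2_unitary_def by blast
  then have "complex_of_real (L2_sq M (\<lambda>t. y t + (-1) * y' t)) = complex_of_real (L2_sq M (\<lambda>t. x t + (-1) * x' t))"
    unfolding Tu complex_of_real_L2_sq L2_inner_class[OF xx(1) xx(1)] L2_inner_class[OF xx(2) xx(2)] .
  then show ?thesis by simp
qed

text \<open>To evaluate the definite description, an operator is built from
  \<open>plancherel_pair\<close> and shown to be the only candidate: its values on truncations are
  prescribed, and isometry forces them on mean-square limits.\<close>

lemma fourier_plancherel_class:
  assumes xy: "plancherel_pair x y"
  shows "fourier_plancherel (L2_class lebesgue x) = L2_class lebesgue y"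
proof -
  let ?M = "lebesgue :: real measure"
  \<comment> \<open>Neither choice affects the result: transforms of almost everywhere equal
    functions agree almost everywhere, so their class is the same.\<close>
  define T where "T = (\<lambda>u\<in>L2_space ?M. L2_class ?M (SOME y. plancherel_pair (L2_rep u) y))"
  have T: "T (L2_class ?M x) = L2_class ?M y" if xy: "plancherel_pair x y" for x y
  proof -
    note L = plancherel_pair_L2[OF xy]
    have "plancherel_pair (L2_rep (L2_class ?M x)) y"
      using L2_rep_class[OF L(1)] L
      by (intro plancherel_pair_cong_AE[OF xy]) (auto simp: L2_measurable elim: eventually_mono)
    moreover from this have p: "plancherel_pair (L2_rep (L2_class ?M x)) (SOME y. plancherel_pair (L2_rep (L2_class ?M x)) y)"
      by (rule someI[of "plancherel_pair (L2_rep (L2_class ?M x))"])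
    ultimately have "L2_class ?M (SOME y. plancherel_pair (L2_rep (L2_class ?M x)) y) = L2_class ?M y"
      by (intro L2_class_eqI plancherel_pair_L2(2)[OF p] L plancherel_pair_unique[OF p])
    then show ?thesis using L by (simp add: T_def L2_class_in_space)
  qed
  have T_cases: "\<exists>x y. plancherel_pair x y \<and> u = L2_class ?M x \<and> T u = L2_class ?M y"
    if u: "u \<in> L2_space ?M" for u
  proof -
    obtain x where x: "x \<in> L2_functions ?M" "u = L2_class ?M x" using u by (rule L2_space_cases)
    obtain y where "plancherel_pair x y" using x(1) by (rule plancherel_pair_exists)
    then show ?thesis using T x(2) by blast
  qed
  have unitary: "L2_unitary ?M T"
    unfolding L2_unitary_def L2_linear_def
  proof (intro conjI ballI allI)
    show "T \<in> L2_space ?M \<rightarrow>\<^sub>E L2_space ?M"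
    proof (rule PiE_I)
      fix u assume "u \<in> L2_space ?M"
      then show "T u \<in> L2_space ?M"
        using T_cases plancherel_pair_L2(2) L2_class_in_space by metis
    qed (simp add: T_def)
  next
    fix u v assume "u \<in> L2_space ?M" "v \<in> L2_space ?M"
    then obtain x y x' y' where *: "plancherel_pair x y" "u = L2_class ?M x" "T u = L2_class ?M y"
        "plancherel_pair x' y'" "v = L2_class ?M x'" "T v = L2_class ?M y'"
      using T_cases by meson
    note L = plancherel_pair_L2[OF *(1)] plancherel_pair_L2[OF *(4)]
    show "T (L2_add ?M u v) = L2_add ?M (T u) (T v)"
      unfolding *(3,6) using T[OF plancherel_pair_add[OF *(1,4)]] L by (simp add: * L2_add_class)
    show "L2_inner ?M (T u) (T v) = L2_inner ?M u v"
      unfolding *(3,6) using plancherel_pair_inner[OF *(1,4)] L by (simp add: * L2_inner_class)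
  next
    fix c u assume "u \<in> L2_space ?M"
    then obtain x y where *: "plancherel_pair x y" "u = L2_class ?M x" "T u = L2_class ?M y"
      using T_cases by meson
    show "T (L2_scale ?M c u) = L2_scale ?M c (T u)"
      unfolding *(3) using T[OF plancherel_pair_cmult[OF *(1)], of c] plancherel_pair_L2[OF *(1)]
      by (simp add: * L2_scale_class)
  next
    show "T ` L2_space ?M = L2_space ?M"
    proof (intro equalityI subsetI)
      fix u assume "u \<in> T ` L2_space ?M"
      then show "u \<in> L2_space ?M"
        using T_cases plancherel_pair_L2(2) L2_class_in_space by (metis imageE)
    next
      fix u assume "u \<in> L2_space ?M"
      then obtain y where y: "y \<in> L2_functions ?M" "u = L2_class ?M y" by (rule L2_space_cases)
      \<comment> \<open>Inversion provides the preimage: the conjugate of the transform of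
        \<open>cnj y\<close> is carried to \<open>y\<close>.\<close>
      obtain v where v: "plancherel_pair (\<lambda>t. cnj (y t)) v"
        using plancherel_pair_exists[OF L2_cnj(1)[OF y(1)]] by blast
      have p: "plancherel_pair (\<lambda>t. cnj (v t)) y"
        using plancherel_pair_inverse[OF v] by simp
      then show "u \<in> T ` L2_space ?M"
        using T[OF p] L2_class_in_space[OF plancherel_pair_L2(1)[OF p]] y(2) by (metis imageI)
    qed
  qed
  let ?P = "\<lambda>T. L2_unitary lebesgue T \<and> (\<forall>x\<in>L2_functions lebesgue. integrable lebesgue x \<longrightarrow>
      T (L2_class lebesgue x) = L2_class lebesgue (fourier x))"
  have "T' = T" if T': "?P T'" for T'
  proof (rule PiE_ext)
    have lin: "L2_linear ?M T'" using T' by (simp add: L2_unitary_def)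
    then show PiE': "T' \<in> L2_space ?M \<rightarrow>\<^sub>E L2_space ?M" by (simp add: L2_linear_def)
    show "T \<in> L2_space ?M \<rightarrow>\<^sub>E L2_space ?M" using unitary by (simp add: L2_unitary_def L2_linear_def)
    fix u assume u: "u \<in> L2_space ?M"
    then obtain x y where *: "plancherel_pair x y" "u = L2_class ?M x" "T u = L2_class ?M y"
      using T_cases by meson
    note L = plancherel_pair_L2[OF *(1)]
    obtain y' where y': "y' \<in> L2_functions ?M" "T' u = L2_class ?M y'"
      using PiE_mem[OF PiE' u] by (rule L2_space_cases)
    have F: "fourier (truncation x n) \<in> L2_functions ?M" for n
      by (intro fourier_L2_contraction(1) truncation_L2 truncation_integrable L)
    \<comment> \<open>The candidate \<open>T'\<close> sends each truncation to its Fourier integral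
      and \<open>x\<close> to \<open>y'\<close>. Isometry converts convergence of the truncations
      into convergence of these integrals, so \<open>y'\<close> is a transform of \<open>x\<close>
      as well.\<close>
    have "L2_sq ?M (\<lambda>t. fourier (truncation x n) t - y' t) = L2_sq ?M (\<lambda>t. truncation x n t - x t)" for n
      using T' y' *(2) truncation_L2[OF L(1)] truncation_integrable[OF L(1)]
      by (intro L2_unitary_sq_diff[of _ T'] F L) auto
    then have "L2_tendsto ?M (\<lambda>n. fourier (truncation x n)) y'"
      using truncation_tendsto[OF L(1)] y' F by (simp add: L2_tendsto_def)
    then have p: "plancherel_pair x y'" using L by (simp add: plancherel_pair_def)
    have "L2_class ?M y' = L2_class ?M y"
      by (intro L2_class_eqI y'(1) L plancherel_pair_unique[OF p *(1)])
    then show "T' u = T u" using y'(2) *(3) by simp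
  qed
  moreover have "?P T" using unitary T plancherel_pair_fourier by blast
  ultimately have "fourier_plancherel = T"
    unfolding fourier_plancherel_def by (intro the_equality)
  then show ?thesis using T[OF xy] by simp
qed

section \<open>Functions on a measurable subset of the line\<close>

definition zero_ext :: "real set \<Rightarrow> (real \<Rightarrow> complex) \<Rightarrow> real \<Rightarrow> complex" where
  "zero_ext E x t = (if t \<in> E then x t else 0)"

lemma zero_ext_indicator: "zero_ext E x t = indicat_real E t *\<^sub>R x t"
  by (simp add: zero_ext_def)

lemma integral_lebesgue_on_zero_ext:
  fixes x :: "real \<Rightarrow> complex"
  assumes "E \<in> sets lebesgue"
  shows "(LINT t|lebesgue_on E. x t) = (LINT t|lebesgue. zero_ext E x t)"
  using assms by (simp add: integral_restrict_space zero_ext_indicator)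

lemma zero_ext_L2_iff:
  fixes x :: "real \<Rightarrow> complex"
  assumes "E \<in> sets lebesgue"
  shows "zero_ext E x \<in> L2_functions lebesgue \<longleftrightarrow> x \<in> L2_functions (lebesgue_on E)"
proof -
  have "(\<lambda>t. indicat_real E t *\<^sub>R (cmod (x t))\<^sup>2) = (\<lambda>t. (cmod (indicat_real E t *\<^sub>R x t))\<^sup>2)"
    by (auto simp: indicator_def)
  then show ?thesis
    using assms by (simp add: L2_functions_def borel_measurable_restrict_space_iff
        integrable_restrict_space zero_ext_indicator[abs_def])
qed

lemma L2_sq_zero_ext:
  fixes x :: "real \<Rightarrow> complex"
  assumes "E \<in> sets lebesgue"
  shows "L2_sq lebesgue (zero_ext E x) = L2_sq (lebesgue_on E) x"
proof -
  have "(\<lambda>t. indicat_real E t *\<^sub>R (cmod (x t))\<^sup>2) = (\<lambda>t. (cmod (indicat_real E t *\<^sub>R x t))\<^sup>2)"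
    by (auto simp: indicator_def)
  then show ?thesis
    using assms by (simp add: L2_sq_def integral_restrict_space zero_ext_indicator)
qed

lemma L2_lebesgue_on:
  fixes x :: "real \<Rightarrow> complex"
  assumes E: "E \<in> sets lebesgue" and x: "x \<in> L2_functions lebesgue"
  shows "x \<in> L2_functions (lebesgue_on E)" and "L2_sq (lebesgue_on E) x \<le> L2_sq lebesgue x"
proof -
  have m: "zero_ext E x \<in> borel_measurable lebesgue"
    using L2_measurable[OF x] E unfolding zero_ext_indicator[abs_def] by measurable
  have i: "integrable lebesgue (\<lambda>t. (cmod (zero_ext E x t))\<^sup>2)"
  proof (rule Bochner_Integration.integrable_bound[OF L2_integrable_sq[OF x]])
    show "(\<lambda>t. (cmod (zero_ext E x t))\<^sup>2) \<in> borel_measurable lebesgue" using m by measurable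
  qed (simp add: zero_ext_def)
  show "x \<in> L2_functions (lebesgue_on E)"
    unfolding zero_ext_L2_iff[OF E, symmetric] using m i by (simp add: L2_functions_def)
  show "L2_sq (lebesgue_on E) x \<le> L2_sq lebesgue x"
    unfolding L2_sq_zero_ext[OF E, symmetric] unfolding L2_sq_def
    by (rule integral_mono[OF i L2_integrable_sq[OF x]]) (simp add: zero_ext_def)
qed

lemma AE_lebesgue_on:
  assumes "E \<in> sets lebesgue"
  shows "(AE t in lebesgue_on E. P t) \<longleftrightarrow> (AE t in lebesgue. t \<in> E \<longrightarrow> P t)"
  using assms by (simp add: AE_restrict_space_iff)

lemma L2_class_lebesgue_on_eqI:
  fixes x y :: "real \<Rightarrow> complex"
  assumes E: "E \<in> sets lebesgue" and "x \<in> L2_functions lebesgue" "y \<in> L2_functions lebesgue"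
    and "AE t in lebesgue. x t = y t"
  shows "L2_class (lebesgue_on E) x = L2_class (lebesgue_on E) y"
  using assms by (intro L2_class_eqI L2_lebesgue_on(1)) (auto simp: AE_lebesgue_on elim: eventually_mono)

section \<open>The truncated Fourier operator\<close>

text \<open>One formula for both branches of the definition. If E has finite measure, its indicator
  is square-integrable, so the zero extension is integrable and its Fourier integral is one of its
  transforms; otherwise \<open>fourier_plancherel_class\<close> applies.\<close>

lemma truncated_fourier_class:
  assumes E: "E \<in> sets lebesgue" and x: "x \<in> L2_functions (lebesgue_on E)"
    and xy: "plancherel_pair (zero_ext E x) y"
  shows "truncated_fourier E (L2_class (lebesgue_on E) x) = L2_class (lebesgue_on E) y"
proof -
  let ?M = "lebesgue_on E"
  \<comment> \<open>The operator acts through the representative chosen by \<open>L2_rep\<close>,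
    which agrees with \<open>x\<close> only almost everywhere on E; \<open>y\<close> has to be
    carried over to it.\<close>
  let ?r = "L2_rep (L2_class ?M x)"
  note L = plancherel_pair_L2[OF xy]
  have r: "zero_ext E ?r \<in> L2_functions lebesgue"
    using L2_rep_class(1)[OF x] by (simp add: zero_ext_L2_iff[OF E])
  have "AE t in lebesgue. zero_ext E x t = zero_ext E ?r t"
    using L2_rep_class(2)[OF x] unfolding AE_lebesgue_on[OF E]
    by eventually_elim (simp add: zero_ext_def)
  then have ry: "plancherel_pair (zero_ext E ?r) y"
    by (intro plancherel_pair_cong_AE[OF xy]) (use r L in \<open>auto simp: L2_measurable\<close>)
  show ?thesis
  proof (cases "emeasure lebesgue E < \<infinity>")
    case True
    have "integrable lebesgue (\<lambda>t. indicat_real E t)" using E True by simp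
    then have "integrable lebesgue (\<lambda>t. (cmod (indicator E t))\<^sup>2)"
      by (rule back_subst[of "integrable lebesgue"]) (auto simp: indicator_def)
    then have "(indicator E :: real \<Rightarrow> complex) \<in> L2_functions lebesgue"
      using E by (simp add: L2_functions_def)
    from L2_mult_integrable[OF r this] have i: "integrable lebesgue (zero_ext E ?r)"
      by (rule back_subst[of "integrable lebesgue"]) (auto simp: zero_ext_def indicator_def)
    have F: "fourier_integral E ?r = fourier (zero_ext E ?r)"
      unfolding fourier_integral_def[of E] fourier_def[abs_def] fun_eq_iff
      by (auto simp: integral_lebesgue_on_zero_ext[OF E] zero_ext_def intro!: Bochner_Integration.integral_cong)
    note p = plancherel_pair_fourier[OF r i]
    have "L2_class ?M (fourier_integral E ?r) = L2_class ?M y"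
      unfolding F by (intro L2_class_lebesgue_on_eqI E L plancherel_pair_L2(2)[OF p] plancherel_pair_unique[OF p ry])
    then show ?thesis
      using True x by (simp add: truncated_fourier_def L2_class_in_space)
  next
    case False
    have "L2_restrict E (fourier_plancherel (L2_extend_by_zero E (L2_class ?M x))) = L2_restrict E (L2_class lebesgue y)"
      using fourier_plancherel_class[OF ry] by (simp add: L2_extend_by_zero_def zero_ext_def[abs_def])
    also have "\<dots> = L2_class ?M y"
      unfolding L2_restrict_def
      by (intro L2_class_lebesgue_on_eqI E L L2_rep_class[OF L(2)])
    finally show ?thesis
      using False x by (simp add: truncated_fourier_def L2_class_in_space)
  qed
qed

lemma truncated_fourier_cases:
  assumes E: "E \<in> sets lebesgue" and u: "u \<in> L2_space (lebesgue_on E)"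
  obtains x y where "x \<in> L2_functions (lebesgue_on E)" "u = L2_class (lebesgue_on E) x"
    "plancherel_pair (zero_ext E x) y" "y \<in> L2_functions (lebesgue_on E)"
    "truncated_fourier E u = L2_class (lebesgue_on E) y"
proof -
  obtain x where x: "x \<in> L2_functions (lebesgue_on E)" "u = L2_class (lebesgue_on E) x"
    using u by (rule L2_space_cases)
  then obtain y where y: "plancherel_pair (zero_ext E x) y"
    using plancherel_pair_exists zero_ext_L2_iff[OF E] by blast
  show ?thesis
    using that[OF x y L2_lebesgue_on(1)[OF E plancherel_pair_L2(2)[OF y]]]
      truncated_fourier_class[OF E x(1) y] x(2) by simp
qed

lemma truncated_fourier_bounded_linear:
  assumes E: "E \<in> sets lebesgue"
  shows "L2_bounded_linear (lebesgue_on E) (truncated_fourier E)"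
  unfolding L2_bounded_linear_def L2_linear_def
proof (intro conjI ballI allI exI)
  let ?M = "lebesgue_on E" and ?A = "truncated_fourier E"
  show "?A \<in> L2_space ?M \<rightarrow>\<^sub>E L2_space ?M"
  proof (rule PiE_I)
    fix u assume "u \<in> L2_space ?M"
    then show "?A u \<in> L2_space ?M"
      by (rule truncated_fourier_cases[OF E]) (simp add: L2_class_in_space)
  qed (simp add: truncated_fourier_def)
  fix u assume u: "u \<in> L2_space ?M"
  then obtain x y where x: "x \<in> L2_functions ?M" "u = L2_class ?M x"
      and y: "plancherel_pair (zero_ext E x) y" "y \<in> L2_functions ?M" "?A u = L2_class ?M y"
    by (rule truncated_fourier_cases[OF E])
  {
    fix v assume "v \<in> L2_space ?M"
    then obtain x' y' where x': "x' \<in> L2_functions ?M" "v = L2_class ?M x'"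
        and y': "plancherel_pair (zero_ext E x') y'" "y' \<in> L2_functions ?M" "?A v = L2_class ?M y'"
      by (rule truncated_fourier_cases[OF E])
    have "zero_ext E (\<lambda>t. x t + x' t) = (\<lambda>t. zero_ext E x t + zero_ext E x' t)"
      by (auto simp: zero_ext_def)
    then have "?A (L2_class ?M (\<lambda>t. x t + x' t)) = L2_class ?M (\<lambda>t. y t + y' t)"
      using plancherel_pair_add[OF y(1) y'(1)] x x' by (intro truncated_fourier_class[OF E] L2_add) auto
    then show "?A (L2_add ?M u v) = L2_add ?M (?A u) (?A v)"
      unfolding y(3) y'(3) using x x' y(2) y'(2) by (simp add: L2_add_class)
  }
  show "?A (L2_scale ?M c u) = L2_scale ?M c (?A u)" for c
  proof -
    have "zero_ext E (\<lambda>t. c * x t) = (\<lambda>t. c * zero_ext E x t)"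
      by (auto simp: zero_ext_def)
    then have "?A (L2_class ?M (\<lambda>t. c * x t)) = L2_class ?M (\<lambda>t. c * y t)"
      using plancherel_pair_cmult[OF y(1), of c] x by (intro truncated_fourier_class[OF E] L2_cmult) auto
    then show ?thesis
      unfolding y(3) using x y(2) by (simp add: L2_scale_class)
  qed
  \<comment> \<open>The bound is 1: zero extension and transform preserve the norm, and restriction
    to E does not increase it.\<close>
  have "L2_sq ?M y \<le> L2_sq ?M x"
    using L2_lebesgue_on(2)[OF E plancherel_pair_L2(2)[OF y(1)]] plancherel_pair_sq[OF y(1)]
    by (simp add: L2_sq_zero_ext[OF E])
  then show "L2_norm ?M (?A u) \<le> 1 * L2_norm ?M u"
    using x y by (simp add: L2_norm_class)
qed

text \<open>The pairing identity moves the transform from the extension of \<open>x\<close> to the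
  conjugated extension of \<open>z\<close>, whose transform is the conjugate of the reflected
  \<open>w\<close> by \<open>plancherel_pair_cnj\<close>.\<close>

lemma truncated_fourier_adjoint_class:
  assumes E: "E \<in> sets lebesgue" and z: "z \<in> L2_functions (lebesgue_on E)"
    and zw: "plancherel_pair (zero_ext E z) w"
  shows "L2_adjoint (lebesgue_on E) (truncated_fourier E) (L2_class (lebesgue_on E) z)
    = L2_class (lebesgue_on E) (\<lambda>t. w (- t))"
proof -
  let ?M = "lebesgue_on E" and ?A = "truncated_fourier E"
  define S where "S = (\<lambda>v\<in>L2_space ?M. L2_class ?M (\<lambda>t. (SOME w. plancherel_pair (zero_ext E (L2_rep v)) w) (- t)))"
  have S: "S (L2_class ?M z) = L2_class ?M (\<lambda>t. w (- t))"
    if z: "z \<in> L2_functions ?M" and zw: "plancherel_pair (zero_ext E z) w" for z w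
  proof -
    let ?r = "L2_rep (L2_class ?M z)"
    note L = plancherel_pair_L2[OF zw]
    have r: "zero_ext E ?r \<in> L2_functions lebesgue"
      using L2_rep_class(1)[OF z] by (simp add: zero_ext_L2_iff[OF E])
    have "AE t in lebesgue. zero_ext E z t = zero_ext E ?r t"
      using L2_rep_class(2)[OF z] unfolding AE_lebesgue_on[OF E]
      by eventually_elim (simp add: zero_ext_def)
    then have rw: "plancherel_pair (zero_ext E ?r) w"
      by (intro plancherel_pair_cong_AE[OF zw]) (use r L in \<open>auto simp: L2_measurable\<close>)
    then have "plancherel_pair (zero_ext E ?r) (SOME w. plancherel_pair (zero_ext E ?r) w)"
      by (rule someI[of "plancherel_pair (zero_ext E ?r)"])
    note p = plancherel_pair_reflect[OF this] plancherel_pair_reflect[OF rw]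
    have "L2_class ?M (\<lambda>t. (SOME w. plancherel_pair (zero_ext E ?r) w) (- t)) = L2_class ?M (\<lambda>t. w (- t))"
      by (intro L2_class_lebesgue_on_eqI E plancherel_pair_unique[OF p] plancherel_pair_L2(2)[OF p(1)]
          plancherel_pair_L2(2)[OF p(2)])
    then show ?thesis using z by (simp add: S_def L2_class_in_space)
  qed
  have "L2_adjoint ?M ?A = S"
  proof (rule L2_adjoint_eqI)
    show "S \<in> L2_space ?M \<rightarrow>\<^sub>E L2_space ?M"
    proof (rule PiE_I)
      fix v assume "v \<in> L2_space ?M"
      then obtain z w where z: "z \<in> L2_functions ?M" "v = L2_class ?M z" "plancherel_pair (zero_ext E z) w"
        by (rule truncated_fourier_cases[OF E])
      then show "S v \<in> L2_space ?M"
        using S[OF z(1,3)] L2_reflect(1)[OF plancherel_pair_L2(2)[OF z(3)]] E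
        by (simp add: L2_class_in_space L2_lebesgue_on)
    qed (simp add: S_def)
    fix u v assume "u \<in> L2_space ?M" "v \<in> L2_space ?M"
    obtain x y where x: "x \<in> L2_functions ?M" "u = L2_class ?M x"
        and y: "plancherel_pair (zero_ext E x) y" "y \<in> L2_functions ?M" "?A u = L2_class ?M y"
      using \<open>u \<in> L2_space ?M\<close> by (rule truncated_fourier_cases[OF E])
    obtain z w where z: "z \<in> L2_functions ?M" "v = L2_class ?M z" and w: "plancherel_pair (zero_ext E z) w"
      using \<open>v \<in> L2_space ?M\<close> by (rule truncated_fourier_cases[OF E])
    have w': "(\<lambda>t. w (- t)) \<in> L2_functions ?M"
      by (intro L2_lebesgue_on(1) E L2_reflect(1) plancherel_pair_L2(2)[OF w])
    have "L2_inner ?M (?A u) v = (LINT t|lebesgue. zero_ext E (\<lambda>t. y t * cnj (z t)) t)"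
      unfolding y(3) z(2) L2_inner_class[OF y(2) z(1)] by (rule integral_lebesgue_on_zero_ext[OF E])
    \<comment> \<open>Restriction to E is shifted onto \<open>z\<close>, leaving \<open>y\<close> as
      a transform on the whole line; after the pairing the factor \<open>x\<close> carries the
      restriction instead.\<close>
    also have "\<dots> = (LINT t|lebesgue. y t * cnj (zero_ext E z t))"
      by (rule Bochner_Integration.integral_cong) (auto simp: zero_ext_def)
    also have "\<dots> = (LINT t|lebesgue. zero_ext E x t * cnj (w (- t)))"
      by (rule plancherel_pair_pairing[OF y(1) plancherel_pair_cnj[OF w]])
    also have "\<dots> = (LINT t|lebesgue. zero_ext E (\<lambda>t. x t * cnj (w (- t))) t)"
      by (rule Bochner_Integration.integral_cong) (auto simp: zero_ext_def)
    also have "\<dots> = L2_inner ?M u (S v)"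
      unfolding x(2) z(2) S[OF z(1) w] L2_inner_class[OF x(1) w']
      by (rule integral_lebesgue_on_zero_ext[OF E, symmetric])
    finally show "L2_inner ?M (?A u) v = L2_inner ?M u (S v)" .
  qed
  then show ?thesis using S[OF z zw] by simp
qed

section \<open>Symmetric sets and normality\<close>

lemma AE_zero_ext_reflect:
  assumes "symmetric_set E" "E \<in> sets lebesgue"
  shows "AE t in lebesgue. zero_ext E y (- t) = zero_ext E (\<lambda>t. y (- t)) t"
proof -
  \<comment> \<open>\<open>emeasure\<close> is 0 by default on non-measurable sets, so the symmetric
    difference is known to be a null set only once the reflection of E is shown to be
    measurable.\<close>
  have "(\<lambda>t. indicat_real E (- t)) \<in> borel_measurable lebesgue"
    using borel_measurable_affine[of "indicat_real E" "-1" 0] assms(2) by simp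
  then have "(\<lambda>t. indicat_real E (- t)) -` {1} \<inter> space lebesgue \<in> sets lebesgue"
    by (rule measurable_sets) simp
  moreover have "(\<lambda>t. indicat_real E (- t)) -` {1} \<inter> space lebesgue = {t. - t \<in> E}"
    by (auto simp: indicator_def)
  ultimately have "(E - {t. - t \<in> E}) \<union> ({t. - t \<in> E} - E) \<in> null_sets lebesgue"
    using assms by (auto simp: symmetric_set_def)
  then show ?thesis
    by (rule AE_I') (auto simp: zero_ext_def)
qed

theorem theorem1p3:
  fixes E :: "real set"
  assumes "E \<in> sets lebesgue"
    and "0 < emeasure lebesgue E"
    and "symmetric_set E"
  shows "L2_normal (lebesgue_on E) (truncated_fourier E)"
  unfolding L2_normal_def
proof (intro conjI ballI)
  let ?M = "lebesgue_on E" and ?A = "truncated_fourier E"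
  note E = assms(1)
  show "L2_bounded_linear ?M ?A" by (rule truncated_fourier_bounded_linear[OF E])
  fix u assume "u \<in> L2_space ?M"
  then obtain x y where x: "x \<in> L2_functions ?M" "u = L2_class ?M x"
      and y: "plancherel_pair (zero_ext E x) y" "y \<in> L2_functions ?M" "?A u = L2_class ?M y"
    by (rule truncated_fourier_cases[OF E])
  have yL: "zero_ext E y \<in> L2_functions lebesgue" using y(2) by (simp add: zero_ext_L2_iff[OF E])
  then obtain w where w: "plancherel_pair (zero_ext E y) w" by (rule plancherel_pair_exists)
  have y': "(\<lambda>t. y (- t)) \<in> L2_functions ?M"
    by (intro L2_lebesgue_on(1) E L2_reflect(1) plancherel_pair_L2(2)[OF y(1)])
  then have "zero_ext E (\<lambda>t. y (- t)) \<in> L2_functions lebesgue" by (simp add: zero_ext_L2_iff[OF E])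
  \<comment> \<open>Symmetry of E enters here: reflecting the zero extension of \<open>y\<close>
    gives, almost everywhere, the zero extension of the reflected \<open>y\<close>. Its transform is
    therefore the reflected \<open>w\<close>, and both products send \<open>u\<close> to the class
    of this function.\<close>
  then have "plancherel_pair (zero_ext E (\<lambda>t. y (- t))) (\<lambda>t. w (- t))"
    using AE_zero_ext_reflect[OF assms(3) E] L2_reflect(1)[OF plancherel_pair_L2(2)[OF w]]
    by (intro plancherel_pair_cong_AE[OF plancherel_pair_reflect[OF w]]) (auto simp: L2_measurable)
  then have "?A (L2_class ?M (\<lambda>t. y (- t))) = L2_class ?M (\<lambda>t. w (- t))"
    by (rule truncated_fourier_class[OF E y'])
  moreover have "L2_adjoint ?M ?A (?A u) = L2_class ?M (\<lambda>t. w (- t))"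
    unfolding y(3) by (rule truncated_fourier_adjoint_class[OF E y(2) w])
  moreover have "L2_adjoint ?M ?A u = L2_class ?M (\<lambda>t. y (- t))"
    unfolding x(2) by (rule truncated_fourier_adjoint_class[OF E x(1) y(1)])
  ultimately show "L2_adjoint ?M ?A (?A u) = ?A (L2_adjoint ?M ?A u)"
    by simp
qed

end
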